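(* Let $X\subset\mathbb{R}^d$ be nonempty. For $i=0,\dots,k$ let $g_i:\mathbb{R}^p\to\mathbb{R}$ be convex and weakly analytic, and for $i=1,\dots,k$ let $\varphi_i:X\to\mathbb{R}$. Put $K(x)=\{y\in\mathbb{R}^p: g_i(y)\le\varphi_i(x),\ i=1,\dots,k\}$, assume $K(x)\neq\emptyset$ for each $x\in X$, and let $\varphi_0(x)=\inf\{g_0(y):y\in K(x)\}$. Suppose that $\varphi_i:X\to\mathbb{R}$ is continuous for each $i=0,\dots,k$ and that $Y=\overline{\operatorname{co}}(K(X))$ (the closed convex hull of $\bigcup_{x\in X}K(x)$) is nonempty and compact. Then the solution map $S:X\rightrightarrows Y$ of the parametric problem $\min_y\{g_0(y): g_i(y)\le\varphi_i(x),\ i=1,\dots,k\}$, i.e. $$S(x)=\{y\in\mathbb{R}^p: g_i(y)\le\varphi_i(x),\ i=0,\dots,k\},$$ is rectangularly continuous on $X$.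
   Context: Weakly analytic: $g:\mathbb{R}^p\to\mathbb{R}$ is weakly analytic if for any $y,u\in\mathbb{R}^p$, whenever $\alpha\mapsto g(y+\alpha u)$ is constant on an open interval, then $g(y+\alpha u)=g(y)$ for all $\alpha\in\mathbb{R}$. Notation: $\operatorname{adim}(A)$ is the dimension of the affine hull of $A$; $d_x:=\operatorname{adim}(S(x))$; $\lambda_k$ is the $k$-dimensional Hausdorff measure, normalized so that it is Lebesgue measure on $k$-dimensional affine subspaces ($\lambda_0$ is counting measure). Rectangular continuity: $S:X\rightrightarrows Y$ with nonempty bounded values is rectangularly continuous at $\bar x\in X$ if there exist set-valued maps $T_0,T_1,R_0,R_1:X\rightrightarrows\mathbb{R}^p$ such that 1. for every $x$ near $\bar x$, $T_0(x)+R_0(x)\subset S(x)\subset T_1(x)+R_1(x)$ (Minkowski sums); 2. for $j=0,1$, $R_j(x)\subset \operatorname{span}(T_j(x)-T_j(x))^{\perp}\cap\operatorname{span}(S(x)-S(x))$, and $T_j$ has constant affine dimension equal to $d_{\bar x}$; 3. for $j=0,1$, $\lim_{x\to\bar x}R_j(x)=\{0\}$ and $\lim_{x\to\bar x}T_j(x)=S(\bar x)$ (Painlevé–Kuratowski set limits); 4. $R_0,R_1$ have measurable values and $\lim_{x\to\bar x}\dfrac{\lambda_{d_x-d_{\bar x}}(R_0(x))}{\lambda_{d_x-d_{\bar x}}(R_1(x))}=1$. $S$ is rectangularly continuous on $X$ if it is so at each point of $X$. *)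

theory Defs
  imports "HOL-Analysis.Analysis"
begin

definition weakly_analytic :: "('a::real_vector \<Rightarrow> real) \<Rightarrow> bool" where
  "weakly_analytic g \<longleftrightarrow>
    (\<forall>y u. (\<exists>a b c. a < b \<and> (\<forall>\<alpha>\<in>{a<..<b}. g (y + \<alpha> *\<^sub>R u) = c))
       \<longrightarrow> (\<forall>\<alpha>. g (y + \<alpha> *\<^sub>R u) = g y))"

(* The k-dimensional Hausdorff outer measure. A set of diameter d is weighted by the volume
   of the k-dimensional ball of diameter d, which makes the measure agree with Lebesgue
   measure on k-dimensional affine subspaces. Empty covering sets get weight 0 (for k = 0 the
   power is 1), so that k = 0 gives the counting measure. Boundedness is explicit because
   diameter is only meaningful for bounded sets. *)

definition hausdorff_content :: "nat \<Rightarrow> real \<Rightarrow> 'a::metric_space set \<Rightarrow> ennreal" where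
  "hausdorff_content k \<delta> A =
    (INF U \<in> {U :: nat \<Rightarrow> 'a set. A \<subseteq> (\<Union>i. U i) \<and> (\<forall>i. bounded (U i) \<and> diameter (U i) \<le> \<delta>)}.
       \<Sum>i. if U i = {} then 0
            else ennreal (unit_ball_vol (real k) * (diameter (U i) / 2) ^ k))"

definition hausdorff_measure :: "nat \<Rightarrow> 'a::metric_space set \<Rightarrow> ennreal" where
  "hausdorff_measure k A = (SUP \<delta>\<in>{0<..}. hausdorff_content k \<delta> A)"

(* Caratheodory measurability with respect to the outer measure above *)
definition hausdorff_measurable :: "nat \<Rightarrow> 'a::metric_space set \<Rightarrow> bool" where
  "hausdorff_measurable k A \<longleftrightarrow> A \<in> lambda_system UNIV (Pow UNIV) (hausdorff_measure k)"

(* Painleve-Kuratowski limits along a filter *)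

definition set_outer_limit :: "('a \<Rightarrow> 'b::topological_space set) \<Rightarrow> 'a filter \<Rightarrow> 'b set" where
  "set_outer_limit T F = {y. \<forall>V. open V \<and> y \<in> V \<longrightarrow> (\<exists>\<^sub>F x in F. T x \<inter> V \<noteq> {})}"

definition set_inner_limit :: "('a \<Rightarrow> 'b::topological_space set) \<Rightarrow> 'a filter \<Rightarrow> 'b set" where
  "set_inner_limit T F = {y. \<forall>V. open V \<and> y \<in> V \<longrightarrow> (\<forall>\<^sub>F x in F. T x \<inter> V \<noteq> {})}"

definition set_limit :: "('a \<Rightarrow> 'b::topological_space set) \<Rightarrow> 'a filter \<Rightarrow> 'b set \<Rightarrow> bool" where
  "set_limit T F L \<longleftrightarrow> set_outer_limit T F = L \<and> set_inner_limit T F = L"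

(* The span of A - A, where A - A is the Minkowski difference (the operator A - B on sets is
   the set-theoretic difference) *)
definition direction_space :: "'a::real_vector set \<Rightarrow> 'a set" where
  "direction_space A = span {a - b | a b. a \<in> A \<and> b \<in> A}"

(* x -> xb is taken within X and, as usual for set limits, does not exclude x = xb; so the
   filter is not "at xb within X". Sums of sets are Minkowski sums. The ratio is formed in
   ennreal, where 0/0 = 0 and t/top = 0; a limit of 1 therefore forces both measures to be
   nonzero and finite near xb. The truncation by nat is harmless: the first condition together with
   nonempty R 0 x gives aff_dim (S x) >= aff_dim (S xb) near xb. *)
definition rectangularly_continuous_at ::
  "'a::topological_space set \<Rightarrow> ('a \<Rightarrow> 'b::euclidean_space set) \<Rightarrow> 'a \<Rightarrow> bool" where
  "rectangularly_continuous_at X S xb \<longleftrightarrow>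
    (let F = inf (nhds xb) (principal X);
         m = (\<lambda>x. nat (aff_dim (S x) - aff_dim (S xb)))
     in \<exists>T R :: nat \<Rightarrow> 'a \<Rightarrow> 'b set.
      (\<forall>\<^sub>F x in F. T 0 x + R 0 x \<subseteq> S x \<and> S x \<subseteq> T 1 x + R 1 x) \<and>
      (\<forall>j\<in>{0, 1}. \<forall>x\<in>X.
         R j x \<subseteq> (direction_space (T j x))\<^sup>\<bottom> \<inter> direction_space (S x) \<and>
         aff_dim (T j x) = aff_dim (S xb)) \<and>
      (\<forall>j\<in>{0, 1}. set_limit (R j) F {0} \<and> set_limit (T j) F (S xb)) \<and>
      (\<forall>j\<in>{0, 1}. \<forall>x\<in>X. hausdorff_measurable (m x) (R j x)) \<and>
      ((\<lambda>x. hausdorff_measure (m x) (R 0 x) / hausdorff_measure (m x) (R 1 x)) \<longlongrightarrow> 1) F)"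

definition rectangularly_continuous_on ::
  "'a::topological_space set \<Rightarrow> ('a \<Rightarrow> 'b::euclidean_space set) \<Rightarrow> bool" where
  "rectangularly_continuous_on X S \<longleftrightarrow>
    (\<forall>x\<in>X. S x \<noteq> {} \<and> bounded (S x)) \<and> (\<forall>x\<in>X. rectangularly_continuous_at X S x)"

end

theory Submission
  imports Defs
begin

text \<open>Fix \<open>xb\<close> and let \<open>L\<close> be the direction space of \<open>S xb\<close> and \<open>yb\<close> a point of its relative
  interior. A constraint that is active on all of \<open>S xb\<close> is constant along \<open>L\<close> near \<open>yb\<close>; by weak
  analyticity it is constant on every line through \<open>yb\<close> in \<open>L\<close>, and by convexity it is then invariant
  under all translations in \<open>L\<close>. So these constraints cut out a cylinder \<open>yb + L + D x\<close> with
  \<open>D x\<close> orthogonal to \<open>L\<close>, and \<open>D x\<close> shrinks to \<open>0\<close> as \<open>x\<close> tends to \<open>xb\<close>. The other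
  constraints are slack at \<open>yb\<close>, so near \<open>xb\<close> they do not affect dimensions. After a translation of
  \<open>D x\<close> by one of its points \<open>d x\<close>, the same set serves as \<open>R\<^sub>0\<close> and \<open>R\<^sub>1\<close>, while \<open>T\<^sub>0\<close> and
  \<open>T\<^sub>1\<close> collect the points of \<open>yb + L\<close> (shifted by \<open>d x\<close>) whose fibre over \<open>D x\<close> lies
  entirely, respectively at some point, in \<open>S x\<close>. The ratio of the measures is then \<open>1\<close> as soon as
  the Hausdorff measure of \<open>D x\<close> in its own dimension is positive and finite.\<close>

section \<open>Hausdorff measure\<close>

text \<open>This is the summand of \<open>hausdorff_content\<close>; naming it lets two covers be
  compared term by term.\<close>

definition diam_weight :: "nat \<Rightarrow> 'a::metric_space set \<Rightarrow> ennreal" where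
  "diam_weight k U =
    (if U = {} then 0 else ennreal (unit_ball_vol (real k) * (diameter U / 2) ^ k))"

lemma diam_weight_empty [simp]: "diam_weight k {} = 0"
  by (simp add: diam_weight_def)

text \<open>The case distinction in the first hypothesis matters for \<open>k = 0\<close>: a
  singleton has the same diameter as the empty set, but weight 1 instead of 0.\<close>

lemma diam_weight_mono:
  assumes "V = {} \<or> U \<noteq> {}" "bounded V" "diameter V \<le> diameter U"
  shows "diam_weight k V \<le> diam_weight k U"
proof (cases "V = {}")
  case False
  have "(diameter V / 2) ^ k \<le> (diameter U / 2) ^ k"
    using assms diameter_ge_0[of V] by (intro power_mono) auto
  moreover have "0 \<le> unit_ball_vol (real k)"
    using unit_ball_vol_pos[of "real k"] by simp
  ultimately show ?thesis
    using assms False by (auto simp: diam_weight_def intro!: ennreal_leI mult_left_mono)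
qed simp

lemma diam_weight_subset:
  assumes "V \<subseteq> U" "bounded U"
  shows "diam_weight k V \<le> diam_weight k U"
  using assms by (intro diam_weight_mono) (auto intro: diameter_subset bounded_subset)

lemma hausdorff_content_le:
  assumes "A \<subseteq> (\<Union>i. U i)" "\<And>i. bounded (U i)" "\<And>i. diameter (U i) \<le> \<delta>"
  shows "hausdorff_content k \<delta> A \<le> (\<Sum>i. diam_weight k (U i))"
  unfolding hausdorff_content_def diam_weight_def using assms by (intro INF_lower) auto

lemma hausdorff_content_geI:
  assumes "\<And>U. A \<subseteq> (\<Union>i. U i) \<Longrightarrow> (\<And>i. bounded (U i)) \<Longrightarrow> (\<And>i. diameter (U i) \<le> \<delta>)
    \<Longrightarrow> c \<le> (\<Sum>i. diam_weight k (U i))"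
  shows "c \<le> hausdorff_content k \<delta> A"
  unfolding hausdorff_content_def using assms unfolding diam_weight_def
  by (intro INF_greatest) auto

lemma hausdorff_content_approx:
  assumes "hausdorff_content k \<delta> A < top" "e > 0"
  obtains U where "A \<subseteq> (\<Union>i. U i)" "\<And>i. bounded (U i)" "\<And>i. diameter (U i) \<le> \<delta>"
    "(\<Sum>i. diam_weight k (U i)) \<le> hausdorff_content k \<delta> A + ennreal e"
  using INF_approx_ennreal[OF assms(2) hausdorff_content_def[of k \<delta> A]] assms(1) that
  unfolding diam_weight_def by (force simp: less_imp_le)

lemma hausdorff_content_mono:
  "A \<subseteq> B \<Longrightarrow> hausdorff_content k \<delta> A \<le> hausdorff_content k \<delta> B"
  by (rule hausdorff_content_geI, rule hausdorff_content_le) auto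

lemma hausdorff_content_antimono:
  "\<delta> \<le> \<epsilon> \<Longrightarrow> hausdorff_content k \<epsilon> A \<le> hausdorff_content k \<delta> A"
  by (rule hausdorff_content_geI, rule hausdorff_content_le) (auto intro: order_trans)

lemma hausdorff_content_empty:
  assumes "\<delta> > 0"
  shows "hausdorff_content k \<delta> ({} :: 'a::metric_space set) = 0"
  using hausdorff_content_le[of "{} :: 'a set" "\<lambda>_. {}" \<delta> k] assms by simp

text \<open>Take for each \<open>A n\<close> a cover that is optimal up to
  \<open>e / 2 ^ (n + 1)\<close>. The errors add up to \<open>e\<close>, and
  \<open>prod_decode\<close> merges the double sequence of covering sets into a single one.\<close>

lemma hausdorff_content_UN:
  "hausdorff_content k \<delta> (\<Union>n::nat. A n) \<le> (\<Sum>n. hausdorff_content k \<delta> (A n))"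
proof (rule ennreal_le_epsilon)
  let ?H = "hausdorff_content k \<delta>"
  fix e :: real
  assume fin: "(\<Sum>n. ?H (A n)) < top" and "0 < e"
  have finA: "?H (A n) < top" for n
    using fin by (rule ennreal_suminf_lessD)
  have "\<exists>U. A n \<subseteq> (\<Union>i. U i) \<and> (\<forall>i. bounded (U i)) \<and> (\<forall>i. diameter (U i) \<le> \<delta>) \<and>
      (\<Sum>i. diam_weight k (U i)) \<le> ?H (A n) + ennreal (e * (1/2) ^ Suc n)" for n
    by (rule hausdorff_content_approx[OF finA[of n], of "e * (1/2) ^ Suc n"]) (use \<open>0 < e\<close> in auto)
  then obtain U where U: "\<And>n. A n \<subseteq> (\<Union>i::nat. U n i)" "\<And>n i. bounded (U n i)"
      "\<And>n i. diameter (U n i) \<le> \<delta>"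
      "\<And>n. (\<Sum>i. diam_weight k (U n i)) \<le> ?H (A n) + ennreal (e * (1/2) ^ Suc n)"
    by metis
  define V where "V p = case_prod U (prod_decode p)" for p
  have "(\<Union>n. A n) \<subseteq> (\<Union>p. V p)"
  proof
    fix x assume "x \<in> (\<Union>n. A n)"
    then obtain n i where "x \<in> U n i" using U(1) by blast
    then have "x \<in> V (prod_encode (n, i))" by (simp add: V_def)
    then show "x \<in> (\<Union>p. V p)" by blast
  qed
  then have "?H (\<Union>n. A n) \<le> (\<Sum>p. diam_weight k (V p))"
    using U by (intro hausdorff_content_le) (auto simp: V_def split: prod.split)
  also have "\<dots> = (\<Sum>p. (\<lambda>(n, i). diam_weight k (U n i)) (prod_decode p))"
    by (simp add: V_def split_beta)
  also have "\<dots> = (\<Sum>n. \<Sum>i. diam_weight k (U n i))"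
    by (subst suminf_ennreal_2dimen) auto
  also have "\<dots> \<le> (\<Sum>n. ?H (A n) + e * (1/2) ^ Suc n)"
    using U(4) by (intro suminf_le) auto
  also have "\<dots> = (\<Sum>n. ?H (A n)) + (\<Sum>n. ennreal e * ennreal ((1/2) ^ Suc n))"
    using \<open>0 < e\<close> by (subst suminf_add[symmetric])
       (auto simp del: ennreal_suminf_cmult simp add: ennreal_mult[symmetric])
  also have "\<dots> = (\<Sum>n. ?H (A n)) + e"
    unfolding ennreal_suminf_cmult
    by (subst suminf_ennreal_eq[OF zero_le_power power_half_series]) auto
  finally show "?H (\<Union>n. A n) \<le> (\<Sum>n. ?H (A n)) + e" .
qed

lemma hausdorff_content_le_measure:
  "\<delta> > 0 \<Longrightarrow> hausdorff_content k \<delta> A \<le> hausdorff_measure k A"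
  unfolding hausdorff_measure_def by (rule SUP_upper) simp

lemma hausdorff_measure_mono:
  "A \<subseteq> B \<Longrightarrow> hausdorff_measure k A \<le> hausdorff_measure k B"
  unfolding hausdorff_measure_def by (intro SUP_mono) (auto intro: hausdorff_content_mono)

lemma hausdorff_measure_empty [simp]: "hausdorff_measure k {} = 0"
  by (simp add: hausdorff_measure_def hausdorff_content_empty SUP_eq_const)

lemma hausdorff_measure_UN:
  "hausdorff_measure k (\<Union>n::nat. A n) \<le> (\<Sum>n. hausdorff_measure k (A n))"
  unfolding hausdorff_measure_def[of k "\<Union>n. A n"]
proof (rule SUP_least)
  fix \<delta> :: real assume "\<delta> \<in> {0<..}"
  then show "hausdorff_content k \<delta> (\<Union>n. A n) \<le> (\<Sum>n. hausdorff_measure k (A n))"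
    by (intro order_trans[OF hausdorff_content_UN] suminf_le)
      (auto intro: hausdorff_content_le_measure)
qed

lemma hausdorff_measure_Un:
  "hausdorff_measure k (A \<union> B) \<le> hausdorff_measure k A + hausdorff_measure k B"
proof -
  have "hausdorff_measure k (A \<union> B) = hausdorff_measure k (\<Union>n::nat. binaryset A B n)"
    by (simp add: UN_binaryset_eq)
  also have "\<dots> \<le> (\<Sum>n. hausdorff_measure k (binaryset A B n))"
    by (rule hausdorff_measure_UN)
  also have "\<dots> = hausdorff_measure k A + hausdorff_measure k B"
    by (rule suminf_binaryset_eq) simp
  finally show ?thesis .
qed

text \<open>A set of diameter below \<open>r\<close> cannot meet both \<open>A\<close> and
  \<open>B\<close>. Hence a fine cover of the union splits into covers of the two parts without any
  increase of the total weight.\<close>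

lemma hausdorff_measure_Un_separated:
  assumes "r > 0" and sep: "\<And>x y. x \<in> A \<Longrightarrow> y \<in> B \<Longrightarrow> r \<le> dist x y"
  shows "hausdorff_measure k A + hausdorff_measure k B \<le> hausdorff_measure k (A \<union> B)"
proof -
  have small: "hausdorff_content k \<delta> A + hausdorff_content k \<delta> B \<le> hausdorff_content k \<delta> (A \<union> B)"
    if "\<delta> < r" for \<delta>
  proof (rule hausdorff_content_geI)
    fix U :: "nat \<Rightarrow> 'a set"
    assume U: "A \<union> B \<subseteq> (\<Union>i. U i)" "\<And>i. bounded (U i)" "\<And>i. diameter (U i) \<le> \<delta>"
    have split: "diam_weight k (U i \<inter> A) + diam_weight k (U i \<inter> B) \<le> diam_weight k (U i)" for i
    proof (cases "U i \<inter> A = {} \<or> U i \<inter> B = {}")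
      case True
      then show ?thesis
        using diam_weight_subset[of "U i \<inter> A" "U i" k] diam_weight_subset[of "U i \<inter> B" "U i" k] U(2)
        by auto
    next
      case False
      then obtain x y where "x \<in> U i" "x \<in> A" "y \<in> U i" "y \<in> B" by auto
      then show ?thesis
        using diameter_bounded_bound[OF U(2)[of i], of x y] sep[of x y] U(3)[of i] that by auto
    qed
    have bd: "bounded (U i \<inter> C)" "diameter (U i \<inter> C) \<le> \<delta>" for i C
      using U(2,3)[of i] diameter_subset[of "U i \<inter> C" "U i"] bounded_subset[of "U i" "U i \<inter> C"]
      by (auto intro: order_trans)
    have "hausdorff_content k \<delta> A + hausdorff_content k \<delta> B
        \<le> (\<Sum>i. diam_weight k (U i \<inter> A)) + (\<Sum>i. diam_weight k (U i \<inter> B))"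
      using U(1) bd by (intro add_mono hausdorff_content_le) auto
    also have "\<dots> = (\<Sum>i. diam_weight k (U i \<inter> A) + diam_weight k (U i \<inter> B))"
      by (subst suminf_add) auto
    also have "\<dots> \<le> (\<Sum>i. diam_weight k (U i))"
      using split by (intro suminf_le) auto
    finally show "hausdorff_content k \<delta> A + hausdorff_content k \<delta> B \<le> (\<Sum>i. diam_weight k (U i))" .
  qed
  \<comment> \<open>The two suprema run over independent scales. Since the content grows as the
    scale shrinks, both scales may be replaced by a common one below \<open>r\<close>.\<close>
  have "hausdorff_content k \<delta> A + hausdorff_content k \<epsilon> B \<le> hausdorff_measure k (A \<union> B)"
    if "\<delta> > 0" "\<epsilon> > 0" for \<delta> \<epsilon>
  proof -
    let ?m = "min (min \<delta> \<epsilon>) (r/2)"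
    have "hausdorff_content k \<delta> A + hausdorff_content k \<epsilon> B
        \<le> hausdorff_content k ?m A + hausdorff_content k ?m B"
      by (intro add_mono hausdorff_content_antimono) auto
    also have "\<dots> \<le> hausdorff_content k ?m (A \<union> B)"
      using \<open>r > 0\<close> by (intro small) auto
    also have "\<dots> \<le> hausdorff_measure k (A \<union> B)"
      using \<open>r > 0\<close> that by (intro hausdorff_content_le_measure) auto
    finally show ?thesis .
  qed
  then show ?thesis
    unfolding hausdorff_measure_def[of k A] hausdorff_measure_def[of k B]
    by (auto simp: ennreal_SUP_add_right simp flip: ennreal_SUP_add_left intro!: SUP_least)
qed

lemma hausdorff_measure_nonexpansive_image:
  fixes f :: "'a::metric_space \<Rightarrow> 'b::metric_space"
  assumes f: "\<And>x y. x \<in> A \<Longrightarrow> y \<in> A \<Longrightarrow> dist (f x) (f y) \<le> dist x y"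
  shows "hausdorff_measure k (f ` A) \<le> hausdorff_measure k A"
proof -
  have "hausdorff_content k \<delta> (f ` A) \<le> hausdorff_content k \<delta> A" for \<delta>
  proof (rule hausdorff_content_geI)
    fix U :: "nat \<Rightarrow> 'a set"
    assume U: "A \<subseteq> (\<Union>i. U i)" "\<And>i. bounded (U i)" "\<And>i. diameter (U i) \<le> \<delta>"
    \<comment> \<open>The covering sets are cut down to \<open>A\<close> first, because
      \<open>f\<close> is controlled only there.\<close>
    let ?V = "\<lambda>i. f ` (U i \<inter> A)"
    have dist_le: "dist u v \<le> diameter (U i)" if "u \<in> ?V i" "v \<in> ?V i" for i u v
    proof -
      obtain x y where "x \<in> U i \<inter> A" "y \<in> U i \<inter> A" "u = f x" "v = f y" using \<open>u \<in> _\<close> \<open>v \<in> _\<close> by auto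
      then show ?thesis
        using f[of x y] diameter_bounded_bound[OF U(2)[of i], of x y] by auto
    qed
    have bd: "bounded (?V i)" for i
      unfolding bounded_two_points using dist_le by blast
    have dm: "diameter (?V i) \<le> diameter (U i)" for i
    proof (cases "?V i = {}")
      case True
      then show ?thesis using diameter_ge_0[OF U(2)[of i]] by simp
    next
      case False
      show ?thesis
        unfolding diameter_def[of "?V i"] using False dist_le[of _ i] by (auto intro!: cSUP_least)
    qed
    have "hausdorff_content k \<delta> (f ` A) \<le> (\<Sum>i. diam_weight k (?V i))"
      using U(1) bd by (intro hausdorff_content_le order_trans[OF dm U(3)]) blast+
    also have "\<dots> \<le> (\<Sum>i. diam_weight k (U i))"
      using bd dm by (intro suminf_le diam_weight_mono) auto
    finally show "hausdorff_content k \<delta> (f ` A) \<le> (\<Sum>i. diam_weight k (U i))" .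
  qed
  then show ?thesis
    unfolding hausdorff_measure_def by (intro SUP_mono) auto
qed

section \<open>Caratheodory measurability of closed sets\<close>

lemma hausdorff_measure_layers:
  fixes A :: "nat \<Rightarrow> 'a::metric_space set"
  assumes sep: "\<And>i j. i < j \<Longrightarrow> \<exists>r>0. \<forall>x\<in>A i. \<forall>y\<in>A j. r \<le> dist x y"
    and sub: "\<And>i. A i \<subseteq> E"
  shows "(\<Sum>i. hausdorff_measure k (A i)) \<le> hausdorff_measure k E"
proof -
  have "(\<Sum>i<n. hausdorff_measure k (A i)) \<le> hausdorff_measure k (\<Union>i<n. A i)" for n
  proof (induction n)
    case 0
    then show ?case by simp
  next
    case (Suc n)
    have "\<exists>r. \<forall>i<n. r i > 0 \<and> (\<forall>x\<in>A i. \<forall>y\<in>A n. r i \<le> dist x y)"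
      using sep[of _ n] by (intro choice) blast
    then obtain r where r: "\<And>i. i < n \<Longrightarrow> r i > 0"
      "\<And>i x y. i < n \<Longrightarrow> x \<in> A i \<Longrightarrow> y \<in> A n \<Longrightarrow> r i \<le> dist x y" by blast
    \<comment> \<open>The new layer keeps a positive distance from the finitely many earlier ones
      together; the element 1 keeps the minimum defined for \<open>n = 0\<close>.\<close>
    define d where "d = Min (insert 1 (r ` {..<n}))"
    have "d > 0" using r(1) by (auto simp: d_def)
    have "d \<le> dist x y" if "x \<in> (\<Union>i<n. A i)" "y \<in> A n" for x y
    proof -
      obtain i where i: "i < n" "x \<in> A i" using \<open>x \<in> _\<close> by auto
      have "d \<le> r i" unfolding d_def using i by (intro Min_le) auto
      then show ?thesis using r(2)[OF i \<open>y \<in> A n\<close>] by simp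
    qed
    then have "hausdorff_measure k (\<Union>i<n. A i) + hausdorff_measure k (A n)
        \<le> hausdorff_measure k ((\<Union>i<n. A i) \<union> A n)"
      by (intro hausdorff_measure_Un_separated[OF \<open>d > 0\<close>])
    also have "(\<Union>i<n. A i) \<union> A n = (\<Union>i<Suc n. A i)"
      by (auto simp: less_Suc_eq)
    finally show ?case
      using Suc by (auto intro: order_trans add_right_mono)
  qed
  also have "hausdorff_measure k (\<Union>i<n. A i) \<le> hausdorff_measure k E" for n
    using sub by (intro hausdorff_measure_mono) auto
  finally show ?thesis
    by (intro suminf_le_const) auto
qed

text \<open>This is Caratheodory's argument for metric outer measures. The part of \<open>E\<close>
  at distance at least \<open>a N\<close> from \<open>C\<close> is separated from \<open>C\<close>,
  so the measure adds up there. What remains of \<open>E - C\<close> is a union of thin layers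
  around \<open>C\<close>, and these have arbitrarily small total measure because the sum over all
  layers converges.\<close>

lemma hausdorff_measurable_closed:
  fixes C :: "'a::metric_space set"
  assumes "closed C"
  shows "hausdorff_measurable k C"
proof (cases "C = {}")
  case True
  then show ?thesis by (simp add: hausdorff_measurable_def lambda_system_def)
next
  case False
  let ?H = "hausdorff_measure k :: 'a set \<Rightarrow> ennreal"
  have "?H (C \<inter> E) + ?H ((UNIV - C) \<inter> E) \<le> ?H E" for E
  proof (rule ennreal_le_epsilon)
    fix e :: real
    assume fin: "?H E < top" and "0 < e"
    define \<rho> where "\<rho> x = infdist x C" for x
    have dist_rho: "\<rho> x - \<rho> y \<le> dist x y" for x y
      using infdist_triangle_abs[of x C y] by (simp add: \<rho>_def abs_le_iff)
    define a where "a n = 1 / real (Suc n)" for n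
    have a: "a n > 0" "m < n \<Longrightarrow> a n < a m" for m n
      by (auto simp: a_def field_simps)
    (* Layers of equal parity are pairwise separated, so their measures have a finite sum. *)
    define L where "L n = {x \<in> E. a (Suc n) \<le> \<rho> x \<and> \<rho> x < a n}" for n
    define F where "F n = {x \<in> E. a n \<le> \<rho> x}" for n
    have sepL: "\<exists>r>0. \<forall>x\<in>L i. \<forall>y\<in>L j. r \<le> dist x y" if "Suc i < j" for i j
    proof (intro exI conjI ballI)
      show "a (Suc i) - a j > 0" using a(2)[OF that] by simp
      fix x y assume "x \<in> L i" "y \<in> L j"
      then show "a (Suc i) - a j \<le> dist x y"
        using dist_rho[of x y] by (auto simp: L_def)
    qed
    have "(\<Sum>n. ?H (L (2 * n))) \<le> ?H E" "(\<Sum>n. ?H (L (2 * n + 1))) \<le> ?H E"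
      by (intro hausdorff_measure_layers sepL; force simp: L_def)+
    then have fin2: "(\<Sum>n. ?H (L (2 * n))) + (\<Sum>n. ?H (L (2 * n + 1))) < top"
      using fin by (auto simp: less_top[symmetric] top_unique)
    have "(\<Sum>i<N. ?H (L i)) \<le> (\<Sum>n. ?H (L (2 * n))) + (\<Sum>n. ?H (L (2 * n + 1)))" for N
    proof -
      have "(\<Sum>i<N. ?H (L i)) \<le> (\<Sum>i<2*N. ?H (L i))"
        by (intro sum_mono2) auto
      also have "\<dots> = (\<Sum>n<N. ?H (L (2 * n)) + ?H (L (2 * n + 1)))"
        by (induction N) (auto simp: algebra_simps)
      also have "\<dots> \<le> (\<Sum>n. ?H (L (2 * n)) + ?H (L (2 * n + 1)))"
        by (intro sum_le_suminf) auto
      also have "\<dots> = (\<Sum>n. ?H (L (2 * n))) + (\<Sum>n. ?H (L (2 * n + 1)))"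
        by (subst suminf_add) auto
      finally show ?thesis .
    qed
    then have finL: "(\<Sum>i. ?H (L i)) < top"
      using fin2 by (intro le_less_trans[OF suminf_le_const]) auto
    define h where "h i = enn2real (?H (L i))" for i
    have h: "?H (L i) = ennreal (h i)" "h i \<ge> 0" for i
      using ennreal_suminf_lessD[OF finL] by (auto simp: h_def)
    have sh: "summable h"
      using finL unfolding h(1) by (intro summable_suminf_not_top h) auto
    obtain N where N: "norm (\<Sum>i. h (i + N)) < e"
      using suminf_exist_split[OF \<open>0 < e\<close> sh] by blast
    have tail: "(\<Sum>i. ?H (L (i + N))) \<le> ennreal e"
      using N h(2) sh unfolding h(1)
      by (subst suminf_ennreal2) (auto intro!: ennreal_leI simp: summable_iff_shift)
    have "(UNIV - C) \<inter> E \<subseteq> F N \<union> (\<Union>i. L (i + N))"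
    proof
      fix x assume x: "x \<in> (UNIV - C) \<inter> E"
      then have "\<rho> x > 0"
        using infdist_pos_not_in_closed[OF assms False] by (auto simp: \<rho>_def)
      then obtain m where "1 / real (Suc m) < \<rho> x"
        using nat_approx_posE by blast
      then have m: "a m \<le> \<rho> x" by (simp add: a_def)
      \<comment> \<open>By minimality \<open>x\<close> fails the bound of the preceding index, which
        places it in the layer \<open>L (n - 1)\<close> unless it already lies in
        \<open>F N\<close>.\<close>
      define n where "n = (LEAST n. a n \<le> \<rho> x)"
      have n: "a n \<le> \<rho> x" unfolding n_def by (rule LeastI[of _ m]) (rule m)
      show "x \<in> F N \<union> (\<Union>i. L (i + N))"
      proof (cases "n \<le> N")
        case True
        then have "a N \<le> a n" using a(2)[of n N] by (cases "n = N") auto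
        then show ?thesis using n x by (auto simp: F_def)
      next
        case False
        then obtain i where i: "n = Suc (i + N)"
          by (metis add.commute less_imp_Suc_add not_le)
        then have "\<not> a (i + N) \<le> \<rho> x"
          using not_less_Least[of "i + N" "\<lambda>n. a n \<le> \<rho> x"] by (simp add: n_def)
        then have "x \<in> L (i + N)" using n x i by (auto simp: L_def)
        then show ?thesis by blast
      qed
    qed
    then have "?H ((UNIV - C) \<inter> E) \<le> ?H (F N \<union> (\<Union>i. L (i + N)))"
      by (rule hausdorff_measure_mono)
    also have "\<dots> \<le> ?H (F N) + ennreal e"
      by (intro order_trans[OF hausdorff_measure_Un] add_left_mono
          order_trans[OF hausdorff_measure_UN tail])
    finally have "?H (C \<inter> E) + ?H ((UNIV - C) \<inter> E) \<le> (?H (C \<inter> E) + ?H (F N)) + ennreal e"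
      by (simp add: add.assoc add_left_mono)
    also have "?H (C \<inter> E) + ?H (F N) \<le> ?H ((C \<inter> E) \<union> F N)"
    proof (rule hausdorff_measure_Un_separated[OF a(1)])
      fix x y assume "x \<in> C \<inter> E" "y \<in> F N"
      then show "a N \<le> dist x y"
        using dist_rho[of y x] by (auto simp: F_def \<rho>_def dist_commute)
    qed
    also have "\<dots> \<le> ?H E"
      by (rule hausdorff_measure_mono) (auto simp: F_def)
    finally show "?H (C \<inter> E) + ?H ((UNIV - C) \<inter> E) \<le> ?H E + ennreal e"
      by (simp add: add_right_mono)
  qed
  moreover have "?H E \<le> ?H (C \<inter> E) + ?H ((UNIV - C) \<inter> E)" for E
    by (rule order_trans[OF hausdorff_measure_mono hausdorff_measure_Un]) auto
  ultimately show ?thesis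
    by (auto simp: hausdorff_measurable_def lambda_system_def intro: antisym)
qed

section \<open>Positivity and finiteness of the measure of convex sets\<close>

lemma hausdorff_content_le_finite:
  assumes "finite J" "A \<subseteq> (\<Union>j\<in>J. Q j)" "0 \<le> \<delta>"
    and "\<And>j. j \<in> J \<Longrightarrow> bounded (Q j)" "\<And>j. j \<in> J \<Longrightarrow> diameter (Q j) \<le> \<delta>"
  shows "hausdorff_content k \<delta> A \<le> (\<Sum>j\<in>J. diam_weight k (Q j))"
proof -
  obtain h where h: "bij_betw h {..<card J} J"
    using ex_bij_betw_nat_finite[OF \<open>finite J\<close>] by (auto simp: atLeast0LessThan)
  \<comment> \<open>The finite cover is padded with empty sets, which weigh nothing even for
    \<open>k = 0\<close>; their diameter 0 has to respect the scale, hence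
    \<open>0 \<le> \<delta>\<close>.\<close>
  define U where "U i = (if i < card J then Q (h i) else {})" for i
  have hJ: "h i \<in> J" if "i < card J" for i
    using bij_betwE[OF h] that by auto
  have "\<exists>i. x \<in> U i" if "x \<in> A" for x
  proof -
    obtain j where j: "j \<in> J" "x \<in> Q j" using assms(2) \<open>x \<in> A\<close> by blast
    then obtain i where "i < card J" "h i = j"
      using bij_betw_imp_surj_on[OF h] by (metis imageE lessThan_iff)
    then show ?thesis using j by (auto simp: U_def intro: exI[of _ i])
  qed
  then have "A \<subseteq> (\<Union>i. U i)" by blast
  then have "hausdorff_content k \<delta> A \<le> (\<Sum>i. diam_weight k (U i))"
    using assms(3-5) hJ by (intro hausdorff_content_le) (simp_all add: U_def)
  also have "\<dots> = (\<Sum>i<card J. diam_weight k (U i))"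
    by (rule suminf_finite) (auto simp: U_def)
  also have "\<dots> = (\<Sum>i<card J. diam_weight k (Q (h i)))"
    by (simp add: U_def)
  also have "\<dots> = (\<Sum>j\<in>J. diam_weight k (Q j))"
    by (rule sum.reindex_bij_betw[OF h])
  finally show ?thesis .
qed

text \<open>With \<open>m = card B\<close>, a cube of side \<open>2 * r\<close> in
  \<open>span B\<close> is cut into \<open>N ^ m\<close> cubes of side \<open>s = 2 * r / N\<close>.
  Bounding each diameter by \<open>m * s\<close>, the total weight is at most a multiple of
  \<open>N ^ m * (m * s / 2) ^ m = (m * r) ^ m\<close>, which does not depend on \<open>N\<close>
  and therefore bounds the content at every scale.\<close>

lemma hausdorff_measure_bounded_coordinates_finite:
  fixes A :: "'a::euclidean_space set"
  assumes B: "B \<subseteq> Basis" and A: "bounded A" "A \<subseteq> span B"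
  shows "hausdorff_measure (card B) A < top"
proof -
  have finB: "finite B" using B finite_Basis finite_subset by blast
  obtain r where r: "r > 0" "\<And>x. x \<in> A \<Longrightarrow> norm x < r"
    using A(1) bounded_pos_less[of A] by auto
  have off: "x \<bullet> b = 0" if "x \<in> span B" "b \<in> Basis - B" for x b
    using that B by (simp add: span_substd_basis)
  define c where "c = unit_ball_vol (card B) * (card B * r) ^ card B"
  have "hausdorff_content (card B) \<delta> A \<le> ennreal c" if "\<delta> > 0" for \<delta>
  proof -
    obtain N0 where "card B * (2 * r) / \<delta> < real N0"
      using reals_Archimedean2 by blast
    then obtain N where N: "N > 0" "card B * (2 * r) / \<delta> < real N"
      by (metis less_trans of_nat_0_less_iff of_nat_less_iff gr_zeroI lessI not_less_iff_gr_or_eq)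
    define s where "s = 2 * r / N"
    have s: "s > 0" "card B * s \<le> \<delta>"
      using N r that by (auto simp: s_def field_simps)
    define Q where "Q j = {x \<in> span B. \<forall>b\<in>B. - r + j b * s \<le> x \<bullet> b \<and> x \<bullet> b \<le> - r + (j b + 1) * s}"
      for j :: "'a \<Rightarrow> nat"
    define J where "J = PiE B (\<lambda>_. {..<N})"
    have "finite J" "card J = N ^ card B"
      using finB by (auto simp: J_def finite_PiE card_PiE)
    have Qd: "norm (x - y) \<le> card B * s" if "x \<in> Q j" "y \<in> Q j" for j x y
    proof -
      have "norm (x - y) \<le> (\<Sum>b\<in>Basis. \<bar>(x - y) \<bullet> b\<bar>)" by (rule norm_le_l1)
      also have "\<dots> = (\<Sum>b\<in>B. \<bar>(x - y) \<bullet> b\<bar>)"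
        using that B by (intro sum.mono_neutral_right) (auto simp: Q_def inner_diff_left off)
      also have "\<dots> \<le> (\<Sum>b\<in>B. s)"
      proof (rule sum_mono)
        fix b assume "b \<in> B"
        then show "\<bar>(x - y) \<bullet> b\<bar> \<le> s"
          using that by (fastforce simp: Q_def inner_diff_left algebra_simps)
      qed
      finally show ?thesis by simp
    qed
    have Qb: "bounded (Q j)" and Qdiam: "diameter (Q j) \<le> card B * s" for j
      using Qd s by (auto simp: bounded_two_points dist_norm intro!: diameter_le)
    have "A \<subseteq> (\<Union>j\<in>J. Q j)"
    proof
      fix x assume "x \<in> A"
      \<comment> \<open>\<open>t b\<close> is the coordinate measured from the corner of the cube in
        units of \<open>s\<close>, so its floor is the index of a small cube containing
        \<open>x\<close>. The restriction to \<open>B\<close> makes \<open>j\<close> an element of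
        the extensional function space \<open>J\<close>.\<close>
      define t where "t b = (x \<bullet> b + r) / s" for b
      define j where "j = restrict (\<lambda>b. nat \<lfloor>t b\<rfloor>) B"
      have tb: "0 \<le> t b" "t b < N" "x \<bullet> b = - r + t b * s" if "b \<in> B" for b
      proof -
        have "\<bar>x \<bullet> b\<bar> < r"
          using r(2)[OF \<open>x \<in> A\<close>] Basis_le_norm[of b x] that B by fastforce
        moreover have "N * s = 2 * r" using N by (simp add: s_def)
        ultimately show "0 \<le> t b" "t b < N" "x \<bullet> b = - r + t b * s"
          using s(1) by (auto simp: t_def field_simps)
      qed
      have "j \<in> J"
        using tb by (auto simp: j_def J_def nat_less_iff floor_less_iff)
      moreover have "x \<in> Q j"
      proof -
        have "- r + j b * s \<le> x \<bullet> b \<and> x \<bullet> b \<le> - r + (j b + 1) * s" if "b \<in> B" for b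
        proof -
          have "real (j b) \<le> t b" "t b \<le> j b + 1"
            using tb(1)[OF that] that unfolding j_def by (simp_all, linarith+)
          then show ?thesis
            unfolding tb(3)[OF that] using s(1) by simp
        qed
        then show ?thesis using \<open>x \<in> A\<close> A(2) by (auto simp: Q_def)
      qed
      ultimately show "x \<in> (\<Union>j\<in>J. Q j)" by blast
    qed
    then have "hausdorff_content (card B) \<delta> A \<le> (\<Sum>j\<in>J. diam_weight (card B) (Q j))"
      using \<open>finite J\<close> Qb order_trans[OF Qdiam s(2)] \<open>\<delta> > 0\<close>
      by (intro hausdorff_content_le_finite) auto
    also have "\<dots> \<le> (\<Sum>j\<in>J. ennreal (unit_ball_vol (card B) * (card B * s / 2) ^ card B))"
    proof (rule sum_mono)
      fix j
      have "(diameter (Q j) / 2) ^ card B \<le> (card B * s / 2) ^ card B"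
        using Qdiam[of j] diameter_ge_0[OF Qb] by (intro power_mono) auto
      moreover have "0 \<le> unit_ball_vol (real (card B))"
        using unit_ball_vol_pos[of "real (card B)"] by simp
      ultimately show "diam_weight (card B) (Q j)
          \<le> ennreal (unit_ball_vol (card B) * (card B * s / 2) ^ card B)"
        by (auto simp: diam_weight_def intro!: ennreal_leI mult_left_mono)
    qed
    also have "\<dots> = ennreal (N ^ card B * (unit_ball_vol (card B) * (card B * s / 2) ^ card B))"
      using \<open>card J = _\<close> by (simp add: ennreal_mult' ennreal_of_nat_eq_real_of_nat)
    also have "N ^ card B * (unit_ball_vol (card B) * (card B * s / 2) ^ card B) = c"
    proof -
      have "N ^ card B * (card B * s / 2) ^ card B = (card B * r) ^ card B"
        unfolding power_mult_distrib[symmetric] of_nat_power using N by (simp add: s_def)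
      then show ?thesis by (simp add: c_def mult_ac)
    qed
    finally show ?thesis .
  qed
  then have "hausdorff_measure (card B) A \<le> ennreal c"
    unfolding hausdorff_measure_def by (intro SUP_least) auto
  then show ?thesis by (rule le_less_trans) simp
qed

text \<open>Thickening by a unit cube in the coordinates outside \<open>B\<close> turns covers of a
  \<open>card B\<close>-dimensional box into covers of a full-dimensional one, which Lebesgue measure controls.\<close>

lemma emeasure_lborel_thick_box:
  fixes p :: "'a::euclidean_space"
  assumes "B \<subseteq> Basis" "0 \<le> d"
  shows "{x. \<forall>b\<in>Basis. if b \<in> B then \<bar>x \<bullet> b - p \<bullet> b\<bar> \<le> d else 0 \<le> x \<bullet> b \<and> x \<bullet> b \<le> 1} \<in> sets lborel"
    and "emeasure lborel {x. \<forall>b\<in>Basis. if b \<in> B then \<bar>x \<bullet> b - p \<bullet> b\<bar> \<le> d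
           else 0 \<le> x \<bullet> b \<and> x \<bullet> b \<le> 1} = ennreal ((2 * d) ^ card B)"
proof -
  define l where "l = (\<Sum>b\<in>Basis. (if b \<in> B then p \<bullet> b - d else 0) *\<^sub>R b)"
  define u where "u = (\<Sum>b\<in>Basis. (if b \<in> B then p \<bullet> b + d else 1) *\<^sub>R b)"
  have lu: "l \<bullet> b = (if b \<in> B then p \<bullet> b - d else 0)" "u \<bullet> b = (if b \<in> B then p \<bullet> b + d else 1)"
    if "b \<in> Basis" for b
    using that by (simp_all add: l_def u_def)
  have eq: "{x. \<forall>b\<in>Basis. if b \<in> B then \<bar>x \<bullet> b - p \<bullet> b\<bar> \<le> d else 0 \<le> x \<bullet> b \<and> x \<bullet> b \<le> 1} = cbox l u"
    by (force simp: mem_box lu abs_le_iff)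
  show "{x. \<forall>b\<in>Basis. if b \<in> B then \<bar>x \<bullet> b - p \<bullet> b\<bar> \<le> d else 0 \<le> x \<bullet> b \<and> x \<bullet> b \<le> 1} \<in> sets lborel"
    unfolding eq by simp
  have "emeasure lborel (cbox l u) = (\<Prod>b\<in>Basis. (u - l) \<bullet> b)"
    using assms by (intro emeasure_lborel_cbox) (auto simp: lu)
  also have "(\<Prod>b\<in>Basis. (u - l) \<bullet> b) = (\<Prod>b\<in>Basis. if b \<in> B then 2 * d else 1)"
    by (intro prod.cong) (auto simp: inner_diff_left lu)
  also have "\<dots> = (\<Prod>b\<in>B. 2 * d)"
    using assms by (simp add: prod.If_cases Int_absorb1)
  finally show "emeasure lborel {x. \<forall>b\<in>Basis. if b \<in> B then \<bar>x \<bullet> b - p \<bullet> b\<bar> \<le> d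
      else 0 \<le> x \<bullet> b \<and> x \<bullet> b \<le> 1} = ennreal ((2 * d) ^ card B)"
    unfolding eq by simp
qed

lemma hausdorff_measure_box_pos:
  fixes A :: "'a::euclidean_space set"
  assumes B: "B \<subseteq> Basis" and "s > 0"
    and A: "\<And>x. (\<forall>b\<in>Basis. if b \<in> B then \<bar>x \<bullet> b - c \<bullet> b\<bar> \<le> s else x \<bullet> b = c \<bullet> b) \<Longrightarrow> x \<in> A"
  shows "hausdorff_measure (card B) A > 0"
proof -
  define Z where "Z p d = {x. \<forall>b\<in>Basis. if b \<in> B then \<bar>x \<bullet> b - p \<bullet> b\<bar> \<le> d
      else 0 \<le> x \<bullet> b \<and> x \<bullet> b \<le> 1}" for p :: 'a and d
  note Z = emeasure_lborel_thick_box[OF B, folded Z_def]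
  \<comment> \<open>A set of diameter \<open>d\<close> lies in a box of half-width \<open>d\<close>
    around any of its points. The factor \<open>v\<close> turns the volume
    \<open>(2 * d) ^ card B\<close> of the thickened box into exactly the weight of that
    set.\<close>
  define v where "v = unit_ball_vol (card B) / 4 ^ card B"
  have "v > 0" by (simp add: v_def)
  have "ennreal (v * (2 * s) ^ card B) \<le> hausdorff_content (card B) 1 A"
  proof (rule hausdorff_content_geI)
    fix U :: "nat \<Rightarrow> 'a set"
    assume U: "A \<subseteq> (\<Union>i. U i)" "\<And>i. bounded (U i)"
    define V where "V i = (if U i = {} then {} else Z (SOME p. p \<in> U i) (diameter (U i)))" for i
    have V: "V i \<in> sets lborel" "ennreal v * emeasure lborel (V i) = diam_weight (card B) (U i)" for i
    proof -
      let ?d = "diameter (U i)"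
      have d: "0 \<le> ?d" by (rule diameter_ge_0[OF U(2)])
      show "V i \<in> sets lborel" using Z(1)[OF d] by (simp add: V_def)
      have "v * (2 * ?d) ^ card B = unit_ball_vol (card B) * (?d / 2) ^ card B"
        unfolding v_def by (simp add: power_mult_distrib power_divide field_simps flip: power_mult_distrib[of 2 2])
      moreover have "ennreal v * ennreal ((2 * ?d) ^ card B) = ennreal (v * (2 * ?d) ^ card B)"
        using d \<open>v > 0\<close> by (simp only: ennreal_mult zero_le_power less_imp_le mult_nonneg_nonneg zero_le_numeral)
      ultimately show "ennreal v * emeasure lborel (V i) = diam_weight (card B) (U i)"
        by (simp only: V_def diam_weight_def Z(2)[OF d] if_distrib[of "\<lambda>V. ennreal v * emeasure lborel V"] emeasure_empty mult_zero_right)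
    qed
    have "Z c s \<subseteq> (\<Union>i. V i)"
    proof
      fix z assume z: "z \<in> Z c s"
      \<comment> \<open>Resetting the coordinates outside \<open>B\<close> to those of
        \<open>c\<close> moves \<open>z\<close> into \<open>A\<close>. Whichever \<open>U i\<close>
        contains the result, \<open>V i\<close> contains \<open>z\<close>, since outside
        \<open>B\<close> it only asks for coordinates between 0 and 1.\<close>
      define x where "x = (\<Sum>b\<in>Basis. (if b \<in> B then z \<bullet> b else c \<bullet> b) *\<^sub>R b)"
      have x: "x \<bullet> b = (if b \<in> B then z \<bullet> b else c \<bullet> b)" if "b \<in> Basis" for b
        using that by (simp add: x_def)
      have "x \<in> A" using z by (intro A) (auto simp: x Z_def)
      then obtain i where i: "x \<in> U i" using U by blast
      define p where "p = (SOME p. p \<in> U i)"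
      have "p \<in> U i" unfolding p_def using i by (rule someI)
      then have d: "norm (x - p) \<le> diameter (U i)"
        using diameter_bounded_bound[OF U(2) i] by (simp add: dist_norm)
      have "\<bar>z \<bullet> b - p \<bullet> b\<bar> \<le> diameter (U i)" if "b \<in> B" for b
        using d Basis_le_norm[of b "x - p"] x[of b] that B by (auto simp: inner_diff_left)
      then have "z \<in> V i" using z i by (auto simp: V_def Z_def p_def[symmetric] split: if_splits)
      then show "z \<in> (\<Union>i. V i)" by blast
    qed
    then have "emeasure lborel (Z c s) \<le> emeasure lborel (\<Union>i. V i)"
      using V(1) by (intro emeasure_mono sets.countable_UN) auto
    also have "\<dots> \<le> (\<Sum>i. emeasure lborel (V i))"
      using V(1) by (intro emeasure_subadditive_countably) auto
    finally have "ennreal v * emeasure lborel (Z c s) \<le> ennreal v * (\<Sum>i. emeasure lborel (V i))"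
      by (rule mult_left_mono) simp
    then show "ennreal (v * (2 * s) ^ card B) \<le> (\<Sum>i. diam_weight (card B) (U i))"
      using Z(2)[of s c] \<open>s > 0\<close> \<open>v > 0\<close> by (simp add: V(2) ennreal_mult' flip: ennreal_suminf_cmult)
  qed
  also have "\<dots> \<le> hausdorff_measure (card B) A"
    by (rule hausdorff_content_le_measure) simp
  finally show ?thesis
    using \<open>s > 0\<close> \<open>v > 0\<close> by (auto intro: less_le_trans[rotated])
qed

text \<open>After a translation, a linear isometry carries the direction space onto the span of
  \<open>m\<close> coordinate vectors. The isometry and its inverse are both nonexpansive, so the
  measure is preserved. There boundedness gives the upper bound, and a box inside the relative
  interior gives the lower one.\<close>

lemma hausdorff_measure_convex:
  fixes A :: "'a::euclidean_space set"
  assumes A: "convex A" "bounded A" and m: "aff_dim A = int m"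
  shows "0 < hausdorff_measure m A" "hausdorff_measure m A < top"
proof -
  obtain a where a: "a \<in> A" using m by force
  define V where "V = span ((+) (- a) ` A)"
  have dimV: "dim V = m"
    using aff_dim_eq_dim[of a A] m a by (simp add: V_def hull_inc)
  then have "m \<le> card (Basis :: 'a set)"
    using dim_subset_UNIV[of V] by simp
  then obtain B :: "'a set" where B: "B \<subseteq> Basis" "card B = m"
    by (rule obtain_subset_with_card_n) 
  have "independent B" using independent_mono[OF independent_Basis B(1)] .
  then have dim: "dim V = dim (span B)"
    using B dimV by (simp add: dim_eq_card_independent)
  have "subspace V" by (simp add: V_def)
  obtain f :: "'a \<Rightarrow> 'a" and g :: "'a \<Rightarrow> 'a" where f: "linear f" "linear g" "f ` V = span B"
      "g ` span B = V" "\<And>x. x \<in> V \<Longrightarrow> norm (f x) = norm x"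
      "\<And>x. x \<in> span B \<Longrightarrow> norm (g x) = norm x" "\<And>x. x \<in> V \<Longrightarrow> g (f x) = x"
    by (rule isometries_subspaces[OF \<open>subspace V\<close> subspace_span dim]) blast
  define A' where "A' = f ` (+) (- a) ` A"
  have sub: "(+) (- a) ` A \<subseteq> V" by (simp add: V_def span_superset)
  have Aeq: "A = (\<lambda>x. a + g x) ` A'"
    using sub f(7) by (force simp: A'_def image_image)
  have sub': "A' \<subseteq> span B" unfolding A'_def using sub f(3) by blast
  have H: "hausdorff_measure m A' = hausdorff_measure m A"
  proof (rule antisym)
    have "f (- a + x) - f (- a + y) = f (x - y)" "x - y \<in> V" if "x \<in> A" "y \<in> A" for x y
    proof -
      show "f (- a + x) - f (- a + y) = f (x - y)"
        using f(1) by (simp flip: linear_diff)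
      have "(- a + x) - (- a + y) \<in> V"
        using sub that unfolding V_def by (intro span_diff) auto
      then show "x - y \<in> V" by simp
    qed
    then show "hausdorff_measure m A' \<le> hausdorff_measure m A"
      unfolding A'_def image_image
      by (intro hausdorff_measure_nonexpansive_image) (simp add: dist_norm f(5))
    have "x - y \<in> span B" if "x \<in> A'" "y \<in> A'" for x y
      using sub' that by (intro span_diff) auto
    then have "hausdorff_measure m ((\<lambda>x. a + g x) ` A') \<le> hausdorff_measure m A'"
      using f(2) by (intro hausdorff_measure_nonexpansive_image) (simp add: dist_norm f(6) flip: linear_diff)
    then show "hausdorff_measure m A \<le> hausdorff_measure m A'"
      by (simp flip: Aeq)
  qed
  have conv: "convex A'"
    unfolding A'_def using A f(1) by (intro convex_linear_image convex_translation)
  have bd: "bounded A'"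
    unfolding A'_def using A f(1)
    by (intro bounded_linear_image bounded_translation) (simp_all add: linear_conv_bounded_linear)
  have "hausdorff_measure (card B) A' < top"
    by (rule hausdorff_measure_bounded_coordinates_finite[OF B(1) bd sub'])
  then show "hausdorff_measure m A < top" by (simp add: B H)
  have "0 \<in> A'" unfolding A'_def using a linear_0[OF f(1)] by (force simp: image_image)
  then have aff: "affine hull A' = span B"
    using f(3) span_linear_image[OF f(1)] by (simp add: affine_hull_span_0 hull_inc A'_def V_def)
  obtain c where "c \<in> rel_interior A'"
    using rel_interior_eq_empty[OF conv] \<open>0 \<in> A'\<close> by blast
  then obtain e where e: "e > 0" "ball c e \<inter> span B \<subseteq> A'" and c: "c \<in> A'"
    unfolding mem_rel_interior_ball aff by blast
  \<comment> \<open>The distance to \<open>c\<close> is then at most \<open>card B * s < e\<close>;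
    the summand 1 also covers \<open>m = 0\<close>.\<close>
  define s where "s = e / (card B + 1)"
  have "hausdorff_measure (card B) A' > 0"
  proof (rule hausdorff_measure_box_pos[OF B(1)])
    show "s > 0" using e by (simp add: s_def)
    fix x assume x: "\<forall>b\<in>Basis. if b \<in> B then \<bar>x \<bullet> b - c \<bullet> b\<bar> \<le> s else x \<bullet> b = c \<bullet> b"
    have "norm (x - c) \<le> (\<Sum>b\<in>Basis. \<bar>(x - c) \<bullet> b\<bar>)" by (rule norm_le_l1)
    also have "\<dots> = (\<Sum>b\<in>B. \<bar>(x - c) \<bullet> b\<bar>)"
      using x B by (intro sum.mono_neutral_right) (auto simp: inner_diff_left)
    also have "\<dots> \<le> (\<Sum>b\<in>B. s)"
      using x B by (intro sum_mono) (auto simp: inner_diff_left)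
    also have "\<dots> < e" using e by (simp add: s_def field_simps)
    finally have "x \<in> ball c e" by (simp add: dist_norm norm_minus_commute)
    moreover have "x \<in> span B"
    proof -
      have "x - c = (\<Sum>b\<in>Basis. ((x - c) \<bullet> b) *\<^sub>R b)" by (simp add: euclidean_representation)
      also have "\<dots> = (\<Sum>b\<in>B. ((x - c) \<bullet> b) *\<^sub>R b)"
        using x B by (intro sum.mono_neutral_right) (auto simp: inner_diff_left)
      also have "\<dots> \<in> span B" by (intro span_sum span_scale span_base)
      finally show ?thesis using c sub' span_add_eq2[of c B "x - c"] by auto
    qed
    ultimately show "x \<in> A'" using e by blast
  qed
  then show "hausdorff_measure m A > 0" by (simp add: B H)
qed

section \<open>Convex functions, direction spaces and set limits\<close>

text \<open>The point \<open>y + u\<close> is the limit, as \<open>t\<close> tends to 0, of points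
  on the segments from \<open>y\<close> to the distant points
  \<open>y0 + (1 / t) *\<^sub>R u\<close>. At these \<open>g\<close> still has the value
  \<open>g y0\<close>, so convexity bounds \<open>g\<close> along the sequence by
  \<open>(1 - t) * g y + t * g y0\<close>.\<close>

lemma convex_on_line_constant_imp_le:
  fixes g :: "'a::euclidean_space \<Rightarrow> real"
  assumes g: "convex_on UNIV g" and const: "\<And>\<alpha>. g (y0 + \<alpha> *\<^sub>R u) = g y0"
  shows "g (y + u) \<le> g y"
proof (rule tendsto_le)
  have cont: "isCont g w" for w
    using convex_on_continuous[OF open_UNIV g] by (simp add: continuous_on_eq_continuous_at)
  show "((\<lambda>t. g (y + u + t *\<^sub>R (y0 - y))) \<longlongrightarrow> g (y + u)) (at_right 0)"
    by (rule isCont_tendsto_compose[OF cont]) (auto intro!: tendsto_eq_intros)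
  show "((\<lambda>t. (1 - t) * g y + t * g y0) \<longlongrightarrow> g y) (at_right 0)"
    by (auto intro!: tendsto_eq_intros)
  show "\<forall>\<^sub>F t in at_right 0. g (y + u + t *\<^sub>R (y0 - y)) \<le> (1 - t) * g y + t * g y0"
    using eventually_at_right_less[of "0::real"] eventually_at_right_real[of 0 1, simplified]
  proof eventually_elim
    case (elim t)
    have "y + u + t *\<^sub>R (y0 - y) = (1 - t) *\<^sub>R y + t *\<^sub>R (y0 + (1 / t) *\<^sub>R u)"
      using elim by (simp add: algebra_simps)
    then show ?case
      using convex_onD[OF g, of t y "y0 + (1 / t) *\<^sub>R u"] const[of "1 / t"] elim by simp
  qed
qed simp

lemma convex_on_line_constant:
  fixes g :: "'a::euclidean_space \<Rightarrow> real"
  assumes g: "convex_on UNIV g" and const: "\<And>\<alpha>. g (y0 + \<alpha> *\<^sub>R u) = g y0"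
  shows "g (y + u) = g y"
proof (rule antisym)
  show "g (y + u) \<le> g y" by (rule convex_on_line_constant_imp_le[OF assms])
  have "g (y0 + \<alpha> *\<^sub>R (- u)) = g y0" for \<alpha>
    using const[of "- \<alpha>"] by simp
  from convex_on_line_constant_imp_le[OF g this, of "y + u"]
  show "g y \<le> g (y + u)" by simp
qed

text \<open>The segment from \<open>y\<close> to \<open>a\<close> can be prolonged a little beyond
  \<open>a\<close> inside \<open>A\<close>. So \<open>a\<close> is a convex combination in which
  \<open>y\<close> has positive weight, and the strict inequality at \<open>y\<close> is
  inherited.\<close>

lemma convex_on_less_rel_interior:
  fixes g :: "'a::euclidean_space \<Rightarrow> real"
  assumes g: "convex_on UNIV g" and A: "convex A" "a \<in> rel_interior A"
    and le: "\<And>y. y \<in> A \<Longrightarrow> g y \<le> c" and y: "y \<in> A" "g y < c"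
  shows "g a < c"
proof -
  obtain m where m: "m > 1" "(1 - m) *\<^sub>R y + m *\<^sub>R a \<in> A"
    using convex_rel_interior_iff[of A a] A y(1) by auto
  let ?w = "(1 - m) *\<^sub>R y + m *\<^sub>R a"
  have "a = (1 - 1 / m) *\<^sub>R y + (1 / m) *\<^sub>R ?w"
    using m(1) by (simp add: algebra_simps diff_divide_distrib)
  then have "g a \<le> (1 - 1 / m) * g y + (1 / m) * g ?w"
    using convex_onD[OF g, of "1 / m" y ?w] m(1) by simp
  also have "\<dots> < (1 - 1 / m) * c + (1 / m) * c"
    using m le[OF m(2)] y(2)
    by (intro add_less_le_mono mult_strict_left_mono mult_left_mono) auto
  finally show ?thesis by (simp add: algebra_simps)
qed

section \<open>Direction spaces and affine dimension\<close>

lemma direction_space_eq: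
  assumes "a \<in> A"
  shows "direction_space A = span ((+) (- a) ` A)"
proof
  show "direction_space A \<subseteq> span ((+) (- a) ` A)"
    unfolding direction_space_def
  proof (rule span_minimal)
    show "{a - b |a b. a \<in> A \<and> b \<in> A} \<subseteq> span ((+) (- a) ` A)"
    proof safe
      fix x y assume "x \<in> A" "y \<in> A"
      then have "(- a + x) - (- a + y) \<in> span ((+) (- a) ` A)"
        by (intro span_diff span_base) auto
      then show "x - y \<in> span ((+) (- a) ` A)" by simp
    qed
  qed simp
  show "span ((+) (- a) ` A) \<subseteq> direction_space A"
    unfolding direction_space_def using assms by (intro span_mono) force
qed

lemma subspace_direction_space [simp]: "subspace (direction_space A)"
  by (simp add: direction_space_def)

lemma diff_in_direction_space: "x \<in> A \<Longrightarrow> y \<in> A \<Longrightarrow> x - y \<in> direction_space A"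
  unfolding direction_space_def by (rule span_base) auto

lemma direction_space_minimal:
  assumes "subspace L" "\<And>x y. x \<in> A \<Longrightarrow> y \<in> A \<Longrightarrow> x - y \<in> L"
  shows "direction_space A \<subseteq> L"
  unfolding direction_space_def using assms by (intro span_minimal) auto

lemma affine_hull_direction_space:
  "a \<in> A \<Longrightarrow> affine hull A = (+) a ` direction_space A"
  using affine_hull_span_gen[of a A] by (simp add: direction_space_eq hull_inc)

lemma aff_dim_direction_space:
  fixes A :: "'a::euclidean_space set"
  assumes "A \<noteq> {}"
  shows "aff_dim A = int (dim (direction_space A))"
proof -
  obtain a where "a \<in> A" using assms by blast
  then show ?thesis using aff_dim_eq_dim[of a A] by (simp add: direction_space_eq hull_inc)
qed

text \<open>\<open>S\<close> lies in the cylinder \<open>a + L + D\<close> and contains the part of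
  it near \<open>L = 0\<close>. Its direction space is therefore the sum of \<open>L\<close> and
  that of \<open>D\<close>; the sum is direct by orthogonality, so the dimensions add.\<close>

lemma direction_space_orthogonal_sum:
  fixes L :: "'a::euclidean_space set"
  assumes L: "subspace L" and D: "D \<subseteq> L\<^sup>\<bottom>" "D \<noteq> {}" and "\<delta> > 0"
    and upper: "S \<subseteq> {a + l + z | l z. l \<in> L \<and> z \<in> D}"
    and lower: "\<And>l z. l \<in> L \<Longrightarrow> norm l < \<delta> \<Longrightarrow> z \<in> D \<Longrightarrow> a + l + z \<in> S"
  shows "direction_space D \<subseteq> direction_space S"
    and "aff_dim S = int (dim L) + aff_dim D"
proof -
  obtain z0 where z0: "z0 \<in> D" using D by blast
  have in_S: "a + z \<in> S" if "z \<in> D" for z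
    using lower[of 0 z] that L \<open>\<delta> > 0\<close> by (simp add: subspace_0)
  show DS: "direction_space D \<subseteq> direction_space S"
  proof (rule direction_space_minimal)
    fix x y assume "x \<in> D" "y \<in> D"
    then show "x - y \<in> direction_space S"
      using diff_in_direction_space[OF in_S[of x] in_S[of y]] by simp
  qed simp
  have LS: "l \<in> direction_space S" if "l \<in> L" for l
  proof -
    \<comment> \<open>\<open>l\<close> is scaled into the ball where \<open>lower\<close> applies;
      the summand 1 avoids a division by 0 at \<open>l = 0\<close>.\<close>
    define t where "t = \<delta> / (2 * (norm l + 1))"
    have nl: "norm l + 1 > 0" by (simp add: add_nonneg_pos)
    then have "t > 0" using \<open>\<delta> > 0\<close> by (simp add: t_def)
    have "norm (t *\<^sub>R l) < \<delta>"
    proof -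
      have "t * norm l \<le> t * (norm l + 1)" using \<open>t > 0\<close> by simp
      also have "\<dots> = \<delta> / 2" using nl by (simp add: t_def divide_simps)
      finally show ?thesis using \<open>\<delta> > 0\<close> \<open>t > 0\<close> by simp
    qed
    then have "a + t *\<^sub>R l + z0 \<in> S"
      using L that z0 by (intro lower) (auto simp: subspace_scale)
    from diff_in_direction_space[OF this in_S[OF z0]] have "t *\<^sub>R l \<in> direction_space S"
      by simp
    then have "(1 / t) *\<^sub>R t *\<^sub>R l \<in> direction_space S"
      using subspace_scale subspace_direction_space by blast
    then show ?thesis using \<open>t > 0\<close> by simp
  qed
  have sum: "direction_space S = {x + y | x y. x \<in> L \<and> y \<in> direction_space D}" (is "_ = ?M")
  proof
    show "?M \<subseteq> direction_space S"
      using LS DS by (auto intro!: subspace_add[OF subspace_direction_space])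
    show "direction_space S \<subseteq> ?M"
    proof (rule direction_space_minimal)
      show "subspace ?M"
        using subspace_sums[OF L subspace_direction_space[of D]] .
      fix x y assume "x \<in> S" "y \<in> S"
      then obtain l z l' z' where "x = a + l + z" "y = a + l' + z'" "l \<in> L" "l' \<in> L" "z \<in> D" "z' \<in> D"
        using upper by blast
      then have "x - y = (l - l') + (z - z')" "l - l' \<in> L" "z - z' \<in> direction_space D"
        using L by (auto simp: subspace_diff diff_in_direction_space)
      then show "x - y \<in> ?M" by blast
    qed
  qed
  have "direction_space D \<subseteq> L\<^sup>\<bottom>"
    using D(1) by (intro direction_space_minimal)
      (auto intro: subspace_diff[OF subspace_orthogonal_comp] simp: subspace_orthogonal_comp)
  then have "L \<inter> direction_space D = {0}"
    using orthogonal_Int_0[OF L] L subspace_0[OF subspace_direction_space[of D]] by (auto simp: subspace_0)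
  then have "dim (direction_space S) = dim L + dim (direction_space D)"
    using dim_sums_Int[OF L subspace_direction_space[of D]] by (simp add: sum)
  then show "aff_dim S = int (dim L) + aff_dim D"
    using aff_dim_direction_space[of S] aff_dim_direction_space[OF D(2)] in_S z0 by fastforce
qed

section \<open>Set limits along a filter\<close>

lemma set_inner_limit_subset_outer: "F \<noteq> bot \<Longrightarrow> set_inner_limit T F \<subseteq> set_outer_limit T F"
  unfolding set_inner_limit_def set_outer_limit_def by (auto intro: eventually_frequently)

lemma set_limitI:
  assumes "F \<noteq> bot" "L \<subseteq> set_inner_limit T F" "set_outer_limit T F \<subseteq> L"
  shows "set_limit T F L"
  using assms set_inner_limit_subset_outer[OF assms(1), of T] unfolding set_limit_def by blast

lemma set_inner_limit_mono:
  assumes "\<forall>\<^sub>F x in F. T x \<subseteq> T' x"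
  shows "set_inner_limit T F \<subseteq> set_inner_limit T' F"
proof
  fix y assume y: "y \<in> set_inner_limit T F"
  show "y \<in> set_inner_limit T' F"
    unfolding set_inner_limit_def
  proof (intro CollectI allI impI)
    fix V assume "open V \<and> y \<in> V"
    then have "\<forall>\<^sub>F x in F. T x \<inter> V \<noteq> {}" using y by (auto simp: set_inner_limit_def)
    with assms show "\<forall>\<^sub>F x in F. T' x \<inter> V \<noteq> {}" by eventually_elim blast
  qed
qed

lemma set_outer_limit_mono:
  assumes "\<forall>\<^sub>F x in F. T x \<subseteq> T' x"
  shows "set_outer_limit T F \<subseteq> set_outer_limit T' F"
proof
  fix y assume y: "y \<in> set_outer_limit T F"
  show "y \<in> set_outer_limit T' F"
    unfolding set_outer_limit_def
  proof (intro CollectI allI impI)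
    fix V assume "open V \<and> y \<in> V"
    then have "\<exists>\<^sub>F x in F. T x \<inter> V \<noteq> {}" using y by (auto simp: set_outer_limit_def)
    then have "\<exists>\<^sub>F x in F. T x \<inter> V \<noteq> {} \<and> T x \<subseteq> T' x"
      by (rule frequently_eventually_frequently[OF _ assms])
    then show "\<exists>\<^sub>F x in F. T' x \<inter> V \<noteq> {}" by (rule frequently_elim1) blast
  qed
qed

lemma set_limit_cong:
  assumes "\<forall>\<^sub>F x in F. T x = T' x"
  shows "set_limit T F L \<longleftrightarrow> set_limit T' F L"
proof -
  have "\<forall>\<^sub>F x in F. T x \<subseteq> T' x" "\<forall>\<^sub>F x in F. T' x \<subseteq> T x"
    using assms by (auto elim: eventually_mono)
  then show ?thesis
    unfolding set_limit_def
    using set_inner_limit_mono[of T T' F] set_inner_limit_mono[of T' T F]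
      set_outer_limit_mono[of T T' F] set_outer_limit_mono[of T' T F] by auto
qed

text \<open>Stated through \<open>at_right 0\<close>, taking the least of finitely many radii
  becomes closure of \<open>eventually\<close> under finite conjunction, with no separate case for
  empty \<open>J\<close>.\<close>

lemma finite_common_radius:
  fixes Q :: "'i \<Rightarrow> real \<Rightarrow> bool"
  assumes "finite J" and "\<And>i. i \<in> J \<Longrightarrow> \<exists>\<delta>>0. Q i \<delta>"
    and "\<And>i \<delta> \<epsilon>. Q i \<delta> \<Longrightarrow> 0 < \<epsilon> \<Longrightarrow> \<epsilon> \<le> \<delta> \<Longrightarrow> Q i \<epsilon>"
  obtains \<delta> where "\<delta> > 0" "\<And>i. i \<in> J \<Longrightarrow> Q i \<delta>"
proof -
  have "\<forall>\<^sub>F \<delta> in at_right 0. \<forall>i\<in>J. Q i \<delta>"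
  proof (rule eventually_ball_finite[OF assms(1)], rule ballI)
    fix i assume "i \<in> J"
    then obtain \<delta> where "\<delta> > 0" "Q i \<delta>" using assms(2) by blast
    then show "\<forall>\<^sub>F \<delta> in at_right 0. Q i \<delta>"
      using assms(3) by (intro eventually_mono[OF eventually_at_right_real[of 0 \<delta>]]) auto
  qed
  then have "\<forall>\<^sub>F \<delta> in at_right 0. 0 < \<delta> \<and> (\<forall>i\<in>J. Q i \<delta>)"
    using eventually_at_right_less[of "0::real"] by eventually_elim simp
  then show ?thesis
    using eventually_happens'[of "at_right (0::real)"] that by fastforce
qed

text \<open>The definition demands orthogonality, dimension and measurability at all points of
  \<open>X\<close>, whereas a construction provides them only near \<open>xb\<close>. At the other
  points \<open>S xb\<close> and the empty set serve as \<open>T\<close> and \<open>R\<close>; this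
  changes neither the limits nor the eventual statements.\<close>

lemma rectangularly_continuous_atI:
  fixes S T0 T1 R :: "'a::topological_space \<Rightarrow> 'b::euclidean_space set"
    and X :: "'a set" and xb :: 'a
  defines "dims \<equiv> \<lambda>x. nat (aff_dim (S x) - aff_dim (S xb))"
  assumes F: "F = inf (nhds xb) (principal X)"
    and sum: "\<forall>\<^sub>F x in F. T0 x + R x \<subseteq> S x \<and> S x \<subseteq> T1 x + R x"
    and dir: "\<forall>\<^sub>F x in F. R x \<subseteq> (direction_space (T0 x))\<^sup>\<bottom> \<and> R x \<subseteq> (direction_space (T1 x))\<^sup>\<bottom> \<and>
      R x \<subseteq> direction_space (S x) \<and> aff_dim (T0 x) = aff_dim (S xb) \<and> aff_dim (T1 x) = aff_dim (S xb)"
    and lim: "set_limit R F {0}" "set_limit T0 F (S xb)" "set_limit T1 F (S xb)"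
    and closed: "\<And>x. closed (R x)"
    and pos: "\<forall>\<^sub>F x in F. 0 < hausdorff_measure (dims x) (R x) \<and> hausdorff_measure (dims x) (R x) < top"
  shows "rectangularly_continuous_at X S xb"
proof -
  define good where "good x \<longleftrightarrow> R x \<subseteq> (direction_space (T0 x))\<^sup>\<bottom> \<and> R x \<subseteq> (direction_space (T1 x))\<^sup>\<bottom> \<and>
      R x \<subseteq> direction_space (S x) \<and> aff_dim (T0 x) = aff_dim (S xb) \<and> aff_dim (T1 x) = aff_dim (S xb)" for x
  define T where "T = (\<lambda>j::nat. \<lambda>x. if good x then if j = 0 then T0 x else T1 x else S xb)"
  define R' where "R' = (\<lambda>j::nat. \<lambda>x. if good x then R x else {})"
  have good: "\<forall>\<^sub>F x in F. good x" using dir by (simp add: good_def)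
  have eqs: "\<forall>\<^sub>F x in F. R' j x = R x" "\<forall>\<^sub>F x in F. T 0 x = T0 x" "\<forall>\<^sub>F x in F. T 1 x = T1 x" for j
    using good by (auto simp: R'_def T_def elim!: eventually_mono)
  have 1: "\<forall>\<^sub>F x in F. T 0 x + R' 0 x \<subseteq> S x \<and> S x \<subseteq> T 1 x + R' 1 x"
    using sum good by eventually_elim (simp add: R'_def T_def)
  have 2: "\<forall>j\<in>{0, 1}. \<forall>x\<in>X. R' j x \<subseteq> (direction_space (T j x))\<^sup>\<bottom> \<inter> direction_space (S x) \<and>
      aff_dim (T j x) = aff_dim (S xb)"
    by (auto simp: R'_def T_def good_def)
  have 3: "\<forall>j\<in>{0, 1}. set_limit (R' j) F {0} \<and> set_limit (T j) F (S xb)"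
    using lim set_limit_cong[OF eqs(1)] set_limit_cong[OF eqs(2)] set_limit_cong[OF eqs(3)] by simp
  have 4: "\<forall>j\<in>{0, 1}. \<forall>x\<in>X. hausdorff_measurable (dims x) (R' j x)"
    using closed by (auto simp: R'_def intro: hausdorff_measurable_closed)
  have "\<forall>\<^sub>F x in F. hausdorff_measure (dims x) (R' 0 x) / hausdorff_measure (dims x) (R' 1 x) = 1"
    using pos good by eventually_elim (auto simp: R'_def intro!: ennreal_divide_self)
  then have 5: "((\<lambda>x. hausdorff_measure (dims x) (R' 0 x) / hausdorff_measure (dims x) (R' 1 x)) \<longlongrightarrow> 1) F"
    by (rule tendsto_eventually)
  show ?thesis
    unfolding rectangularly_continuous_at_def Let_def F[symmetric]
    using 1 2 3 4 5 unfolding dims_def by blast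
qed

section \<open>Rectangular continuity of sublevel maps\<close>

text \<open>The objective is not singled out: it counts as one more constraint, with the optimal
  value as its level. That the optimum is attained enters only through
  \<open>S_nonempty\<close>.\<close>

locale sublevel_map =
  fixes J :: "'i set" and g :: "'i \<Rightarrow> 'b::euclidean_space \<Rightarrow> real"
    and \<phi> :: "'i \<Rightarrow> 'a::topological_space \<Rightarrow> real" and X :: "'a set" and xb :: 'a
    and S :: "'a \<Rightarrow> 'b set"
  assumes finite_J: "finite J"
    and convex_g: "i \<in> J \<Longrightarrow> convex_on UNIV (g i)"
    and analytic_g: "i \<in> J \<Longrightarrow> weakly_analytic (g i)"
    and xb: "xb \<in> X"
    and cont_\<phi>: "i \<in> J \<Longrightarrow> continuous_on X (\<phi> i)"
    and S_eq: "S x = {y. \<forall>i\<in>J. g i y \<le> \<phi> i x}"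
    and S_nonempty: "x \<in> X \<Longrightarrow> S x \<noteq> {}"
begin

text \<open>\<open>P x\<close> and \<open>Q x\<close> are recorded as offsets in \<open>L\<close> from \<open>yb\<close>; adding \<open>yb + d x\<close> turns them into
  the inner and outer sets \<open>T0 x\<close> and \<open>T1 x\<close>.\<close>

definition "F = inf (nhds xb) (principal X)"
definition "L = direction_space (S xb)"
definition "yb = (SOME y. y \<in> rel_interior (S xb))"
definition "I = {i \<in> J. \<forall>y\<in>S xb. g i y = \<phi> i xb}"
definition "D x = {z \<in> L\<^sup>\<bottom>. \<forall>i\<in>I. g i (yb + z) \<le> \<phi> i x}"
definition "P x = {l \<in> L. \<forall>z\<in>D x. yb + l + z \<in> S x}"
definition "Q x = {l \<in> L. \<exists>z\<in>D x. yb + l + z \<in> S x}"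
definition "d x = (SOME z. z \<in> D x)"

section \<open>Basic properties of the level sets and of the constraints\<close>

lemma I_subset: "I \<subseteq> J"
  by (auto simp: I_def)

lemma subspace_L: "subspace L"
  by (simp add: L_def)

lemma F_nonbot: "F \<noteq> bot"
proof -
  have "\<exists>\<^sub>F x in F. x = xb"
    unfolding F_def frequently_def eventually_inf_principal
    using xb by (auto dest: eventually_nhds_x_imp_x)
  then show ?thesis by (auto simp: frequently_def)
qed

lemma eventually_X: "\<forall>\<^sub>F x in F. x \<in> X"
  by (simp add: F_def eventually_inf_principal)

lemma tendsto_\<phi>: "i \<in> J \<Longrightarrow> (\<phi> i \<longlongrightarrow> \<phi> i xb) F"
  using cont_\<phi> xb unfolding F_def continuous_on_def
  by (simp add: tendsto_at_iff_tendsto_nhds_within)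

lemma isCont_g: "i \<in> J \<Longrightarrow> isCont (g i) y"
  using convex_on_continuous[OF open_UNIV convex_g] by (simp add: continuous_on_eq_continuous_at)

lemma convex_g_le:
  "i \<in> J \<Longrightarrow> 0 \<le> t \<Longrightarrow> t \<le> 1 \<Longrightarrow> g i ((1 - t) *\<^sub>R x + t *\<^sub>R y) \<le> (1 - t) * g i x + t * g i y"
  using convex_onD[OF convex_g] by simp

lemma convex_combination_le:
  assumes "i \<in> J" "0 \<le> u" "0 \<le> v" "u + v = 1" "g i x \<le> c" "g i y \<le> c"
  shows "g i (u *\<^sub>R x + v *\<^sub>R y) \<le> c"
proof -
  have u: "u = 1 - v" using assms(4) by simp
  have "g i (u *\<^sub>R x + v *\<^sub>R y) \<le> (1 - v) * g i x + v * g i y"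
    unfolding u using assms by (intro convex_g_le) auto
  also have "\<dots> \<le> (1 - v) * c + v * c"
    using assms by (intro add_mono mult_left_mono) auto
  finally show ?thesis by (simp add: algebra_simps)
qed

lemma convex_S: "convex (S x)"
  unfolding convex_def S_eq using convex_combination_le by blast

lemma yb_rel_interior: "yb \<in> rel_interior (S xb)"
proof -
  obtain y where "y \<in> rel_interior (S xb)"
    using rel_interior_eq_empty[OF convex_S] S_nonempty[OF xb] by blast
  then show ?thesis unfolding yb_def by (rule someI)
qed

lemma yb_S: "yb \<in> S xb"
  using yb_rel_interior rel_interior_subset by blast

lemma affine_hull_S: "affine hull (S xb) = (+) yb ` L"
  using affine_hull_direction_space[OF yb_S] by (simp add: L_def)

lemma S_in_affine: "y \<in> S xb \<Longrightarrow> y - yb \<in> L"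
  unfolding L_def using diff_in_direction_space yb_S by blast

text \<open>This is where weak analyticity enters. Near \<open>yb\<close> the line in direction
  \<open>l\<close> stays in \<open>S xb\<close>, where \<open>g i\<close> equals
  \<open>\<phi> i xb\<close>, so \<open>g i\<close> is constant on the whole line; convexity then
  transfers this to the parallel line through \<open>y\<close>.\<close>

lemma g_invariant:
  assumes "i \<in> I" "l \<in> L"
  shows "g i (y + l) = g i y"
proof -
  have i: "i \<in> J" using assms I_subset by blast
  obtain e where e: "e > 0" "ball yb e \<inter> (+) yb ` L \<subseteq> S xb"
    using yb_rel_interior unfolding mem_rel_interior_ball affine_hull_S by blast
  define t where "t = e / (norm l + 1)"
  have nl: "norm l + 1 > 0" by (simp add: add_nonneg_pos)
  then have "t > 0" using e by (simp add: t_def)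
  have "g i (yb + \<alpha> *\<^sub>R l) = \<phi> i xb" if "\<alpha> \<in> {- t<..<t}" for \<alpha>
  proof -
    have "\<bar>\<alpha>\<bar> * norm l \<le> \<bar>\<alpha>\<bar> * (norm l + 1)" by (simp add: algebra_simps)
    also have "\<dots> < t * (norm l + 1)"
      using that nl by (intro mult_strict_right_mono) auto
    also have "\<dots> = e" using nl by (simp add: t_def)
    finally have "yb + \<alpha> *\<^sub>R l \<in> ball yb e" by (simp add: dist_norm)
    then have "yb + \<alpha> *\<^sub>R l \<in> S xb"
      using e(2) subspace_scale[OF subspace_L assms(2)] by blast
    then show ?thesis using assms by (auto simp: I_def)
  qed
  then have "\<exists>a b c. a < b \<and> (\<forall>\<alpha>\<in>{a<..<b}. g i (yb + \<alpha> *\<^sub>R l) = c)"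
    using \<open>t > 0\<close> by (intro exI[of _ "- t"] exI[of _ t] exI[of _ "\<phi> i xb"]) auto
  then have "\<And>\<alpha>. g i (yb + \<alpha> *\<^sub>R l) = g i yb"
    using analytic_g[OF i] unfolding weakly_analytic_def by blast
  then show ?thesis by (rule convex_on_line_constant[OF convex_g[OF i]])
qed

text \<open>Slack at a single point of \<open>S xb\<close> spreads by convexity to every point of
  the relative interior.\<close>

lemma g_yb_strict:
  assumes "i \<in> J - I"
  shows "g i yb < \<phi> i xb"
proof -
  obtain y where y: "y \<in> S xb" "g i y \<noteq> \<phi> i xb" using assms by (auto simp: I_def)
  show ?thesis
  proof (rule convex_on_less_rel_interior[OF convex_g convex_S yb_rel_interior])
    show "g i y < \<phi> i xb" using y assms by (auto simp: S_eq less_le)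
  qed (use y assms in \<open>auto simp: S_eq\<close>)
qed

section \<open>The slice \<open>D\<close> orthogonal to \<open>L\<close>\<close>

lemma orthogonal_decomposition:
  obtains l z where "l \<in> L" "z \<in> L\<^sup>\<bottom>" "y = l + z"
proof -
  have "y \<in> L + L\<^sup>\<bottom>" using subspace_sum_orthogonal_comp[OF subspace_L] by simp
  then show ?thesis using that by (rule set_plus_elim)
qed

text \<open>The constraints in \<open>I\<close> do not see the component in \<open>L\<close>, so the
  orthogonal component alone already satisfies them.\<close>

lemma S_decomposition:
  assumes "y \<in> S x"
  obtains l z where "l \<in> Q x" "z \<in> D x" "y = yb + l + z"
proof -
  obtain l z where lz: "l \<in> L" "z \<in> L\<^sup>\<bottom>" "y - yb = l + z"
    by (rule orthogonal_decomposition)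
  then have y: "y = yb + l + z" by (simp add: algebra_simps)
  have "g i (yb + z) \<le> \<phi> i x" if "i \<in> I" for i
  proof -
    have "g i (yb + z) = g i y"
      using g_invariant[OF that lz(1), of "yb + z"] by (simp add: y add_ac)
    then show ?thesis using assms that I_subset by (auto simp: S_eq)
  qed
  then have "z \<in> D x" using lz by (simp add: D_def)
  then show ?thesis using that[of l z] lz(1) y assms by (auto simp: Q_def)
qed

lemma d_in_D:
  assumes "x \<in> X"
  shows "d x \<in> D x"
proof -
  obtain y where "y \<in> S x" using S_nonempty[OF assms] by blast
  then obtain l z where "z \<in> D x" by (rule S_decomposition)
  then show ?thesis unfolding d_def by (rule someI)
qed

text \<open>For small \<open>t > 0\<close> the point \<open>yb + t *\<^sub>R z\<close> satisfies
  every constraint: those in \<open>I\<close> by convexity between \<open>yb\<close> and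
  \<open>yb + z\<close>, the others by their slack at \<open>yb\<close>. So it lies in
  \<open>S xb\<close>, which puts \<open>z\<close> into \<open>L\<close> as well as into
  \<open>L\<^sup>\<bottom>\<close>.\<close>

lemma D_xb: "D xb \<subseteq> {0}"
proof
  fix z assume z: "z \<in> D xb"
  have "\<forall>\<^sub>F t in at_right (0::real). g i (yb + t *\<^sub>R z) \<le> \<phi> i xb" if "i \<in> J" for i
  proof (cases "i \<in> I")
    case True
    have "g i (yb + t *\<^sub>R z) \<le> \<phi> i xb" if t: "0 < t" "t < 1" for t
    proof -
      have "yb + t *\<^sub>R z = (1 - t) *\<^sub>R yb + t *\<^sub>R (yb + z)" by (simp add: algebra_simps)
      then show ?thesis
        using t z yb_S \<open>i \<in> J\<close> True convex_combination_le[of i "1 - t" t yb "\<phi> i xb" "yb + z"]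
        by (auto simp: D_def S_eq)
    qed
    then show ?thesis
      by (intro eventually_mono[OF eventually_at_right_real[of 0 1]]) auto
  next
    case False
    have "((\<lambda>t. g i (yb + t *\<^sub>R z)) \<longlongrightarrow> g i yb) (at_right 0)"
      by (rule isCont_tendsto_compose[OF isCont_g[OF that]]) (auto intro!: tendsto_eq_intros)
    then have "\<forall>\<^sub>F t in at_right 0. g i (yb + t *\<^sub>R z) < \<phi> i xb"
      using g_yb_strict False that by (intro order_tendstoD) auto
    then show ?thesis by (auto elim: eventually_mono)
  qed
  then have ev: "\<forall>\<^sub>F t in at_right 0. 0 < t \<and> yb + t *\<^sub>R z \<in> S xb"
    unfolding S_eq using eventually_at_right_less[of "0::real"]
    by (simp add: eventually_ball_finite[OF finite_J] eventually_conj_iff)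
  then obtain t where t: "t > 0" "yb + t *\<^sub>R z \<in> S xb"
    using eventually_happens'[OF _ ev] by auto
  have "(1 / t) *\<^sub>R (yb + t *\<^sub>R z - yb) \<in> L"
    by (intro subspace_scale[OF subspace_L] S_in_affine t)
  then have "z \<in> L" using t by simp
  moreover have "z \<in> L\<^sup>\<bottom>" using z by (simp add: D_def)
  ultimately show "z \<in> {0}" using orthogonal_Int_0[OF subspace_L] by blast
qed

text \<open>The constraints in \<open>I\<close> are violated by a definite amount on a sphere of \<open>L\<^sup>\<bottom>\<close>, hence by
  convexity also outside of it, and this survives small perturbations of the levels.\<close>

lemma D_small:
  assumes "r > 0"
  shows "\<forall>\<^sub>F x in F. D x \<subseteq> ball 0 r"
proof -
  let ?K = "sphere 0 r \<inter> L\<^sup>\<bottom>"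
  \<comment> \<open>\<open>h\<close> is the total violation of the constraints in \<open>I\<close>.
    It is positive on the sphere by \<open>D_xb\<close>, and compactness gives a positive minimum;
    the sphere is empty if \<open>L\<close> is the whole space.\<close>
  define h where "h z = (\<Sum>i\<in>I. max 0 (g i (yb + z) - \<phi> i xb))" for z
  have "\<exists>\<epsilon>>0. \<forall>z\<in>?K. \<epsilon> \<le> h z"
  proof (cases "?K = {}")
    case False
    have "continuous_on ?K h"
      unfolding h_def using I_subset
      by (intro continuous_at_imp_continuous_on ballI continuous_intros isCont_o2[OF _ isCont_g]) auto
    moreover have "compact ?K"
      by (intro compact_Int_closed closed_subspace subspace_orthogonal_comp) simp
    ultimately obtain z0 where z0: "z0 \<in> ?K" "\<And>z. z \<in> ?K \<Longrightarrow> h z0 \<le> h z"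
      using continuous_attains_inf[of ?K h] False by blast
    have "z0 \<notin> D xb" using D_xb z0(1) assms by auto
    then obtain i where i: "i \<in> I" "g i (yb + z0) > \<phi> i xb"
      using z0(1) by (auto simp: D_def not_le)
    have "h z0 > 0"
      unfolding h_def using i finite_subset[OF I_subset finite_J]
      by (intro sum_pos2[of I i]) auto
    then show ?thesis using z0(2) by blast
  qed (auto intro: exI[of _ 1])
  then obtain \<epsilon> where \<epsilon>: "\<epsilon> > 0" "\<And>z. z \<in> ?K \<Longrightarrow> \<epsilon> \<le> h z" by blast
  \<comment> \<open>A violation of at most \<open>\<eta>\<close> in each constraint of
    \<open>I\<close> adds up to less than \<open>\<epsilon>\<close>, also if \<open>I\<close> is
    empty.\<close>
  define \<eta> where "\<eta> = \<epsilon> / (card I + 1)"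
  have "\<eta> > 0" using \<epsilon> by (simp add: \<eta>_def)
  have "\<forall>\<^sub>F x in F. \<forall>i\<in>I. \<phi> i x < \<phi> i xb + \<eta>"
    using I_subset \<open>\<eta> > 0\<close>
    by (intro eventually_ball_finite ballI order_tendstoD[OF tendsto_\<phi>] finite_subset[OF I_subset finite_J]) auto
  then show ?thesis
  proof eventually_elim
    case (elim x)
    show ?case
    proof (rule subsetI, rule ccontr)
      fix z assume z: "z \<in> D x" "z \<notin> ball 0 r"
      define t where "t = r / norm z"
      have "norm z > 0" "r \<le> norm z" using z assms by auto
      then have t: "0 < t" "t \<le> 1" "norm (t *\<^sub>R z) = r" using assms by (auto simp: t_def)
      have "t *\<^sub>R z \<in> ?K"
        using z t by (auto simp: D_def intro: subspace_scale[OF subspace_orthogonal_comp])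
      then have "\<epsilon> \<le> h (t *\<^sub>R z)" by (rule \<epsilon>)
      also have "\<dots> \<le> (\<Sum>i\<in>I. \<eta>)"
        unfolding h_def
      proof (rule sum_mono)
        fix i assume i: "i \<in> I"
        have "yb + t *\<^sub>R z = (1 - t) *\<^sub>R yb + t *\<^sub>R (yb + z)" by (simp add: algebra_simps)
        moreover have "g i yb \<le> \<phi> i xb + \<eta>" "g i (yb + z) \<le> \<phi> i xb + \<eta>"
          using i z elim yb_S I_subset \<open>\<eta> > 0\<close> by (force simp: D_def S_eq)+
        ultimately have "g i (yb + t *\<^sub>R z) \<le> \<phi> i xb + \<eta>"
          using t i I_subset convex_combination_le[of i "1 - t" t yb "\<phi> i xb + \<eta>" "yb + z"] by auto
        then show "max 0 (g i (yb + t *\<^sub>R z) - \<phi> i xb) \<le> \<eta>" using \<open>\<eta> > 0\<close> by simp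
      qed
      also have "\<dots> < \<epsilon>" using \<epsilon> by (simp add: \<eta>_def field_simps)
      finally show False by simp
    qed
  qed
qed

text \<open>The constraints in \<open>I\<close> hold for free, being invariant along
  \<open>L\<close>. Each of the others holds on a ball around \<open>yb + l0\<close> for all
  \<open>x\<close> near \<open>xb\<close>; half of the common radius is spent on \<open>l\<close>
  and half on \<open>z\<close>, by \<open>D_small\<close>.\<close>

lemma P_neighbourhood:
  assumes l0: "l0 \<in> L" and strict: "\<And>i. i \<in> J - I \<Longrightarrow> g i (yb + l0) < \<phi> i xb"
  obtains \<delta> where "\<delta> > 0" "\<forall>\<^sub>F x in F. \<forall>l\<in>L. dist l l0 < \<delta> \<longrightarrow> l \<in> P x"
proof -
  define good where "good i r \<longleftrightarrow> (\<forall>\<^sub>F x in F. \<forall>y\<in>ball (yb + l0) r. g i y \<le> \<phi> i x)" for i r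
  have "\<exists>r>0. good i r" if i: "i \<in> J - I" for i
  proof -
    \<comment> \<open>The intermediate value \<open>c\<close> separates the variation of
      \<open>y\<close> from that of \<open>x\<close>.\<close>
    obtain c where c: "g i (yb + l0) < c" "c < \<phi> i xb" using strict[OF i] dense by blast
    have "\<forall>\<^sub>F y in nhds (yb + l0). g i y < c"
      using isCont_g[of i "yb + l0"] i c by (intro order_tendstoD) (auto simp: isCont_def tendsto_at_iff_tendsto_nhds)
    then obtain r where r: "r > 0" "\<And>y. dist y (yb + l0) < r \<Longrightarrow> g i y < c"
      by (auto simp: eventually_nhds_metric)
    have "\<forall>\<^sub>F x in F. c < \<phi> i x" using i c by (intro order_tendstoD[OF tendsto_\<phi>]) auto
    then have "good i r"
      unfolding good_def by (rule eventually_mono) (use r in \<open>force simp: dist_commute\<close>)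
    then show ?thesis using r by blast
  qed
  moreover have "finite (J - I)" using finite_J by simp
  moreover have "good i \<epsilon>" if "good i \<delta>" "0 < \<epsilon>" "\<epsilon> \<le> \<delta>" for i \<delta> \<epsilon>
    using that(1) unfolding good_def by (rule eventually_mono) (use that(3) in auto)
  ultimately obtain r where r: "r > 0" "\<And>i. i \<in> J - I \<Longrightarrow> good i r"
    using finite_common_radius[of "J - I" good] by metis
  have "\<forall>\<^sub>F x in F. \<forall>i\<in>J - I. \<forall>y\<in>ball (yb + l0) r. g i y \<le> \<phi> i x"
    using r(2) finite_J by (intro eventually_ball_finite) (auto simp: good_def)
  moreover have "\<forall>\<^sub>F x in F. D x \<subseteq> ball 0 (r / 2)" using r(1) by (intro D_small) simp
  ultimately have "\<forall>\<^sub>F x in F. \<forall>l\<in>L. dist l l0 < r / 2 \<longrightarrow> l \<in> P x"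
  proof eventually_elim
    case (elim x)
    show ?case
    proof (intro ballI impI)
      fix l assume l: "l \<in> L" "dist l l0 < r / 2"
      have "g i (yb + l + z) \<le> \<phi> i x" if z: "z \<in> D x" and i: "i \<in> J" for i z
      proof (cases "i \<in> I")
        case True
        have "g i (yb + l + z) = g i (yb + z)"
          using g_invariant[OF True l(1), of "yb + z"] by (simp add: add_ac)
        then show ?thesis using z True by (simp add: D_def)
      next
        case False
        have "norm z < r / 2" using z elim by auto
        moreover have "norm ((yb + l0) - (yb + l + z)) \<le> norm (l - l0) + norm z"
          using norm_triangle_ineq[of "l - l0" z]
          by (subst norm_minus_commute) (simp add: algebra_simps)
        ultimately have "dist (yb + l0) (yb + l + z) < r"
          using l(2) unfolding dist_norm by linarith
        then show ?thesis using elim False i by auto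
      qed
      then show "l \<in> P x" using l by (auto simp: P_def S_eq)
    qed
  qed
  then show ?thesis using that[of "r / 2"] r by simp
qed

lemma P_neighbourhood_0:
  obtains \<delta> where "\<delta> > 0" "\<forall>\<^sub>F x in F. \<forall>l\<in>L. norm l < \<delta> \<longrightarrow> l \<in> P x"
proof -
  obtain \<delta> where "\<delta> > 0" "\<forall>\<^sub>F x in F. \<forall>l\<in>L. dist l 0 < \<delta> \<longrightarrow> l \<in> P x"
    by (rule P_neighbourhood[of 0]) (use g_yb_strict subspace_0[OF subspace_L] in auto)
  then show ?thesis using that by simp
qed

section \<open>The maps \<open>T0\<close>, \<open>T1\<close> and \<open>R\<close>\<close>

definition "T0 x = (+) (yb + d x) ` P x"
definition "T1 x = (+) (yb + d x) ` Q x"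
text \<open>For \<open>x\<close> in \<open>X\<close>, subtracting \<open>d x\<close> makes the
  elements of \<open>R x\<close> differences of points of \<open>D x\<close>, as containment in
  \<open>direction_space (S x)\<close> requires. The opposite shift in \<open>T0\<close> and
  \<open>T1\<close> leaves the Minkowski sums unchanged.\<close>

definition "R x = (+) (- d x) ` D x"

lemma D_subset: "D x \<subseteq> L\<^sup>\<bottom>"
  by (auto simp: D_def)

lemma convex_D: "convex (D x)"
proof (rule convexI)
  fix a b u v assume *: "a \<in> D x" "b \<in> D x" "0 \<le> u" "0 \<le> v" "u + v = (1::real)"
  have "yb + (u *\<^sub>R a + v *\<^sub>R b) = u *\<^sub>R (yb + a) + v *\<^sub>R (yb + b)"
    using *(5) by (simp add: algebra_simps flip: scaleR_add_left)
  then show "u *\<^sub>R a + v *\<^sub>R b \<in> D x"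
    using * I_subset unfolding D_def
    by (auto intro!: convex_combination_le subspace_add subspace_scale subspace_orthogonal_comp)
qed

lemma closed_D: "closed (D x)"
proof -
  have D_eq: "D x = L\<^sup>\<bottom> \<inter> (\<Inter>i\<in>I. {z. g i (yb + z) \<le> \<phi> i x})"
    by (auto simp: D_def)
  have "closed (\<Inter>i\<in>I. {z. g i (yb + z) \<le> \<phi> i x})"
  proof (rule closed_INT, rule ballI)
    fix i assume "i \<in> I"
    then show "closed {z. g i (yb + z) \<le> \<phi> i x}"
      using I_subset
      by (intro closed_Collect_le continuous_at_imp_continuous_on ballI continuous_intros
        isCont_o2[OF _ isCont_g]) auto
  qed
  then show ?thesis
    unfolding D_eq by (intro closed_Int closed_subspace[OF subspace_orthogonal_comp])
qed

lemma P_subset_Q: "x \<in> X \<Longrightarrow> P x \<subseteq> Q x"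
  using d_in_D by (auto simp: P_def Q_def)

lemma eventually_sandwich:
  "\<forall>\<^sub>F x in F. T0 x + R x \<subseteq> S x \<and> S x \<subseteq> T1 x + R x"
proof (rule always_eventually, intro allI conjI)
  fix x
  show "T0 x + R x \<subseteq> S x"
  proof
    fix y assume "y \<in> T0 x + R x"
    then obtain l z where "l \<in> P x" "z \<in> D x" "y = (yb + d x + l) + (- d x + z)"
      by (auto simp: T0_def R_def set_plus_def)
    moreover from this have "y = yb + l + z" by simp
    ultimately show "y \<in> S x" by (simp add: P_def)
  qed
  show "S x \<subseteq> T1 x + R x"
  proof
    fix y assume "y \<in> S x"
    then obtain l z where *: "l \<in> Q x" "z \<in> D x" "y = yb + l + z" by (rule S_decomposition)
    then have "y = (yb + d x + l) + (- d x + z)" by simp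
    moreover have "yb + d x + l \<in> T1 x" "- d x + z \<in> R x" using * by (auto simp: T1_def R_def)
    ultimately show "y \<in> T1 x + R x" by (metis set_plus_intro)
  qed
qed

lemma translate_orthogonal:
  assumes "x \<in> X" "M \<subseteq> L"
  shows "R x \<subseteq> (direction_space ((+) v ` M))\<^sup>\<bottom>"
proof -
  have "direction_space ((+) v ` M) \<subseteq> L"
  proof (rule direction_space_minimal[OF subspace_L])
    fix a b assume "a \<in> (+) v ` M" "b \<in> (+) v ` M"
    then obtain a' b' where "a = v + a'" "b = v + b'" "a' \<in> L" "b' \<in> L" using assms(2) by blast
    then show "a - b \<in> L" by (simp add: subspace_diff[OF subspace_L])
  qed
  then have "L\<^sup>\<bottom> \<subseteq> (direction_space ((+) v ` M))\<^sup>\<bottom>" by (rule orthogonal_comp_anti_mono)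
  moreover have "R x \<subseteq> L\<^sup>\<bottom>"
  proof
    fix y assume "y \<in> R x"
    then obtain z where z: "z \<in> D x" "y = z - d x" by (auto simp: R_def)
    then have "z \<in> L\<^sup>\<bottom>" "d x \<in> L\<^sup>\<bottom>" using D_subset d_in_D[OF assms(1)] by blast+
    then show "y \<in> L\<^sup>\<bottom>" unfolding z(2) by (rule subspace_diff[OF subspace_orthogonal_comp])
  qed
  ultimately show ?thesis by blast
qed

lemma aff_dim_S_xb: "aff_dim (S xb) = int (dim L)"
  unfolding L_def using yb_S by (intro aff_dim_direction_space) blast

text \<open>Near \<open>xb\<close> the set \<open>P x\<close> contains a fixed ball of
  \<open>L\<close> around 0. This supplies the lower inclusion of
  \<open>direction_space_orthogonal_sum\<close> and gives \<open>P x\<close> and \<open>Q x\<close>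
  the full dimension of \<open>L\<close>.\<close>

lemma eventually_dimensions:
  "\<forall>\<^sub>F x in F. aff_dim (S x) = aff_dim (S xb) + aff_dim (D x) \<and> R x \<subseteq> direction_space (S x) \<and>
     aff_dim (T0 x) = aff_dim (S xb) \<and> aff_dim (T1 x) = aff_dim (S xb)"
proof -
  obtain \<delta> where "\<delta> > 0" and ev: "\<forall>\<^sub>F x in F. \<forall>l\<in>L. norm l < \<delta> \<longrightarrow> l \<in> P x"
    by (rule P_neighbourhood_0)
  from ev eventually_X show ?thesis
  proof eventually_elim
    case (elim x)
    have upper: "S x \<subseteq> {yb + l + z |l z. l \<in> L \<and> z \<in> D x}"
    proof
      fix y assume "y \<in> S x"
      then obtain l z where "l \<in> Q x" "z \<in> D x" "y = yb + l + z" by (rule S_decomposition)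
      then show "y \<in> {yb + l + z |l z. l \<in> L \<and> z \<in> D x}" by (auto simp: Q_def)
    qed
    have lower: "yb + l + z \<in> S x" if "l \<in> L" "norm l < \<delta>" "z \<in> D x" for l z
      using elim(1) that by (auto simp: P_def)
    have D_ne: "D x \<noteq> {}" using d_in_D[OF elim(2)] by blast
    note sum = direction_space_orthogonal_sum[OF subspace_L D_subset D_ne \<open>\<delta> > 0\<close> upper lower]
    have "R x \<subseteq> direction_space (D x)"
      using d_in_D[OF elim(2)] diff_in_direction_space[of _ "D x" "d x"] by (auto simp: R_def)
    moreover have "aff_dim M = int (dim L)" if "P x \<subseteq> M" "M \<subseteq> L" for M
    proof (rule antisym)
      show "aff_dim M \<le> int (dim L)"
        using aff_dim_subset[OF \<open>M \<subseteq> L\<close>] by (simp add: aff_dim_subspace subspace_L)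
      have "0 \<in> L \<inter> ball 0 \<delta>" using \<open>\<delta> > 0\<close> subspace_0[OF subspace_L] by simp
      then have "aff_dim (L \<inter> ball 0 \<delta>) = aff_dim L"
        by (intro aff_dim_convex_Int_open subspace_imp_convex subspace_L) auto
      moreover have "L \<inter> ball 0 \<delta> \<subseteq> M" using elim(1) that by auto
      ultimately show "int (dim L) \<le> aff_dim M"
        using aff_dim_subset[of "L \<inter> ball 0 \<delta>" M] by (simp add: aff_dim_subspace subspace_L)
    qed
    moreover have "Q x \<subseteq> L" "P x \<subseteq> L" by (auto simp: P_def Q_def)
    ultimately show ?case
      using sum P_subset_Q[OF elim(2)] unfolding T0_def T1_def aff_dim_translation_eq aff_dim_S_xb
      by auto
  qed
qed

section \<open>Set limits of \<open>R\<close>, \<open>T0\<close> and \<open>T1\<close>\<close>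

lemma set_limit_R: "set_limit R F {0}"
proof (rule set_limitI[OF F_nonbot])
  show "{0} \<subseteq> set_inner_limit R F"
    unfolding set_inner_limit_def using d_in_D
    by (auto simp: R_def disjoint_iff intro!: eventually_mono[OF eventually_X] bexI[of _ "d _"])
  show "set_outer_limit R F \<subseteq> {0}"
  proof (rule subsetI, rule ccontr)
    fix y assume y: "y \<in> set_outer_limit R F" "y \<notin> {0}"
    \<comment> \<open>An element \<open>z - d x\<close> of \<open>R x\<close> has norm below
      \<open>2 * r\<close>, so within \<open>r\<close> of it there is no point of norm
      \<open>4 * r\<close>.\<close>
    define r where "r = norm y / 4"
    have "r > 0" using y by (simp add: r_def)
    then have "\<exists>\<^sub>F x in F. R x \<inter> ball y r \<noteq> {}"
      using y unfolding set_outer_limit_def by auto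
    moreover have "\<forall>\<^sub>F x in F. D x \<subseteq> ball 0 r \<and> x \<in> X"
      using D_small[OF \<open>r > 0\<close>] eventually_X by (rule eventually_conj)
    ultimately have "\<exists>\<^sub>F x in F. R x \<inter> ball y r \<noteq> {} \<and> D x \<subseteq> ball 0 r \<and> x \<in> X"
      by (rule frequently_eventually_frequently)
    then obtain x z where x: "D x \<subseteq> ball 0 r" "x \<in> X" "z \<in> D x" "dist y (z - d x) < r"
      by (auto simp: R_def dest!: frequently_ex)
    have "norm z < r" "norm (d x) < r" using x d_in_D[OF x(2)] by auto
    then show False
      using x(4) norm_triangle_ineq4[of z "d x"] norm_triangle_ineq2[of y "z - d x"] \<open>r > 0\<close>
      unfolding dist_norm r_def by linarith
  qed
qed

text \<open>At \<open>y\<close> itself constraints outside \<open>I\<close> may be active. Moving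
  \<open>y\<close> slightly towards \<open>yb\<close> makes them all strict, so that
  \<open>P_neighbourhood\<close> applies; the remaining shift by \<open>d x\<close> tends to
  0.\<close>

lemma S_subset_inner_T0: "S xb \<subseteq> set_inner_limit T0 F"
proof
  fix y assume y: "y \<in> S xb"
  define l where "l = y - yb"
  have l: "l \<in> L" unfolding l_def using S_in_affine[OF y] .
  show "y \<in> set_inner_limit T0 F"
    unfolding set_inner_limit_def
  proof (intro CollectI allI impI)
    fix V assume V: "open V \<and> y \<in> V"
    have "((\<lambda>t. yb + (1 - t) *\<^sub>R l) \<longlongrightarrow> y) (at_right 0)"
      by (auto intro!: tendsto_eq_intros simp: l_def)
    then have "\<forall>\<^sub>F t in at_right 0. yb + (1 - t) *\<^sub>R l \<in> V"
      using V by (intro topological_tendstoD) auto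
    then have "\<forall>\<^sub>F t in at_right 0. yb + (1 - t) *\<^sub>R l \<in> V \<and> t \<in> {0<..<1}"
      using eventually_at_right_real[OF zero_less_one] by eventually_elim simp
    then obtain t where t: "yb + (1 - t) *\<^sub>R l \<in> V" "0 < t" "t < 1"
      using eventually_happens'[of "at_right (0::real)"] by fastforce
    obtain r where r: "r > 0" "ball (yb + (1 - t) *\<^sub>R l) r \<subseteq> V"
      using t(1) V openE by blast
    have "g i (yb + (1 - t) *\<^sub>R l) < \<phi> i xb" if "i \<in> J - I" for i
    proof -
      have "yb + (1 - t) *\<^sub>R l = t *\<^sub>R yb + (1 - t) *\<^sub>R y"
        by (simp add: l_def algebra_simps)
      then have "g i (yb + (1 - t) *\<^sub>R l) \<le> t * g i yb + (1 - t) * g i y"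
        using convex_g_le[of i "1 - t" yb y] t that by simp
      also have "\<dots> < t * \<phi> i xb + (1 - t) * \<phi> i xb"
        using g_yb_strict[OF that] y t that
        by (intro add_less_le_mono mult_strict_left_mono mult_left_mono) (auto simp: S_eq)
      finally show ?thesis by (simp add: algebra_simps)
    qed
    then obtain \<delta> where \<delta>: "\<delta> > 0" "\<forall>\<^sub>F x in F. \<forall>l'\<in>L. dist l' ((1 - t) *\<^sub>R l) < \<delta> \<longrightarrow> l' \<in> P x"
      by (rule P_neighbourhood[OF subspace_scale[OF subspace_L l]])
    from \<delta>(2) D_small[OF r(1)] eventually_X
    show "\<forall>\<^sub>F x in F. T0 x \<inter> V \<noteq> {}"
    proof eventually_elim
      case (elim x)
      have "(1 - t) *\<^sub>R l \<in> P x"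
        using elim(1) \<delta>(1) subspace_scale[OF subspace_L l] by auto
      then have "yb + d x + (1 - t) *\<^sub>R l \<in> T0 x" by (auto simp: T0_def)
      moreover have "norm (d x) < r" using elim(2) d_in_D[OF elim(3)] by auto
      then have "yb + d x + (1 - t) *\<^sub>R l \<in> ball (yb + (1 - t) *\<^sub>R l) r"
        by (simp add: dist_norm)
      then have "yb + d x + (1 - t) *\<^sub>R l \<in> V" using r(2) by blast
      ultimately show ?case by blast
    qed
  qed
qed

text \<open>A constraint violated at \<open>y\<close> is violated by a margin on a ball around
  \<open>y\<close>. A point of \<open>T1 x\<close> differs from a point of \<open>S x\<close> only
  by some \<open>z - d x\<close>, so with the budget \<open>r / 2 + r / 4 + r / 4\<close> that point
  of \<open>S x\<close> would lie in the ball.\<close>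

lemma outer_T1_subset: "set_outer_limit T1 F \<subseteq> S xb"
proof (rule subsetI, rule ccontr)
  fix y assume y: "y \<in> set_outer_limit T1 F" "y \<notin> S xb"
  then obtain i where i: "i \<in> J" "\<phi> i xb < g i y" by (auto simp: S_eq not_le)
  obtain c where c: "\<phi> i xb < c" "c < g i y" using i(2) dense by blast
  have "\<forall>\<^sub>F w in nhds y. c < g i w"
    using isCont_g[OF i(1), of y] c by (intro order_tendstoD) (auto simp: isCont_def tendsto_at_iff_tendsto_nhds)
  then obtain r where r: "r > 0" "\<And>w. dist w y < r \<Longrightarrow> c < g i w"
    by (auto simp: eventually_nhds_metric)
  have "\<exists>\<^sub>F x in F. T1 x \<inter> ball y (r / 2) \<noteq> {}"
    using y(1) r(1) unfolding set_outer_limit_def by auto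
  moreover have "\<forall>\<^sub>F x in F. D x \<subseteq> ball 0 (r / 4) \<and> x \<in> X \<and> \<phi> i x < c"
    using r(1) c by (intro eventually_conj D_small eventually_X order_tendstoD[OF tendsto_\<phi>[OF i(1)]]) auto
  ultimately have "\<exists>\<^sub>F x in F. T1 x \<inter> ball y (r / 2) \<noteq> {} \<and> D x \<subseteq> ball 0 (r / 4) \<and> x \<in> X \<and> \<phi> i x < c"
    by (rule frequently_eventually_frequently)
  then obtain x l where x: "D x \<subseteq> ball 0 (r / 4)" "x \<in> X" "\<phi> i x < c" "l \<in> Q x"
      "dist y (yb + d x + l) < r / 2"
    by (auto simp: T1_def dest!: frequently_ex)
  obtain z where z: "z \<in> D x" "yb + l + z \<in> S x" using x(4) by (auto simp: Q_def)
  have "norm z < r / 4" "norm (d x) < r / 4" using x z d_in_D[OF x(2)] by auto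
  moreover have "yb + l + z - y = (z - d x) - (y - (yb + d x + l))" by (simp add: algebra_simps)
  then have "norm (yb + l + z - y) \<le> norm (z - d x) + norm (y - (yb + d x + l))"
    by (simp only: norm_triangle_ineq4)
  ultimately have "dist (yb + l + z) y < r"
    using x(5) norm_triangle_ineq4[of z "d x"] unfolding dist_norm by linarith
  then have "c < g i (yb + l + z)" by (rule r(2))
  then show False using z(2) i(1) x(3) by (auto simp: S_eq)
qed

text \<open>Since \<open>T0 x\<close> lies in \<open>T1 x\<close>, the inner bound for the smaller
  map and the outer bound for the larger one settle both limits.\<close>

lemma set_limit_T: "set_limit T0 F (S xb)" "set_limit T1 F (S xb)"
proof -
  have sub: "\<forall>\<^sub>F x in F. T0 x \<subseteq> T1 x"
    using eventually_X by eventually_elim (use P_subset_Q in \<open>auto simp: T0_def T1_def\<close>)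
  show "set_limit T0 F (S xb)"
    using S_subset_inner_T0 outer_T1_subset set_outer_limit_mono[OF sub] by (intro set_limitI F_nonbot) auto
  show "set_limit T1 F (S xb)"
    using S_subset_inner_T0 outer_T1_subset set_inner_limit_mono[OF sub] by (intro set_limitI F_nonbot) auto
qed

lemma rectangularly_continuous: "rectangularly_continuous_at X S xb"
proof (rule rectangularly_continuous_atI[where ?T0.0 = T0 and ?T1.0 = T1 and R = R, OF F_def])
  show "\<forall>\<^sub>F x in F. T0 x + R x \<subseteq> S x \<and> S x \<subseteq> T1 x + R x" by (rule eventually_sandwich)
  show "\<forall>\<^sub>F x in F. R x \<subseteq> (direction_space (T0 x))\<^sup>\<bottom> \<and> R x \<subseteq> (direction_space (T1 x))\<^sup>\<bottom> \<and>
      R x \<subseteq> direction_space (S x) \<and> aff_dim (T0 x) = aff_dim (S xb) \<and> aff_dim (T1 x) = aff_dim (S xb)"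
    using eventually_dimensions eventually_X
  proof eventually_elim
    case (elim x)
    then show ?case
      using translate_orthogonal[of x "P x"] translate_orthogonal[of x "Q x"]
      by (auto simp: T0_def T1_def P_def Q_def)
  qed
  show "closed (R x)" for x unfolding R_def by (intro closed_translation closed_D)
  show "\<forall>\<^sub>F x in F. 0 < hausdorff_measure (nat (aff_dim (S x) - aff_dim (S xb))) (R x) \<and>
      hausdorff_measure (nat (aff_dim (S x) - aff_dim (S xb))) (R x) < top"
    using eventually_dimensions eventually_X D_small[OF zero_less_one]
  proof eventually_elim
    case (elim x)
    \<comment> \<open>Nonnegativity ensures that \<open>nat\<close> truncates nothing, so the
      exponent of the measure is the dimension of \<open>R x\<close> itself.\<close>
    have "aff_dim (D x) \<ge> 0"
      using d_in_D[OF elim(2)] aff_dim_direction_space[of "D x"] by force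
    moreover have "aff_dim (R x) = aff_dim (D x)"
      unfolding R_def by (rule aff_dim_translation_eq)
    ultimately have "aff_dim (R x) = int (nat (aff_dim (S x) - aff_dim (S xb)))"
      using elim(1) by simp
    moreover have "convex (R x)" "bounded (R x)"
      unfolding R_def using convex_translation[OF convex_D]
        bounded_translation[OF bounded_subset[OF bounded_ball elim(3)]] by blast+
    ultimately show ?case using hausdorff_measure_convex by blast
  qed
qed (rule set_limit_R set_limit_T)+

end

section \<open>The parametric optimization problem\<close>

theorem theorem6:
  fixes X :: "(real ^ 'd) set"
    and k :: nat
    and g :: "nat \<Rightarrow> real ^ 'p \<Rightarrow> real"
    and \<phi> :: "nat \<Rightarrow> real ^ 'd \<Rightarrow> real"
    and K S :: "real ^ 'd \<Rightarrow> (real ^ 'p) set"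
    and Y :: "(real ^ 'p) set"
  assumes "X \<noteq> {}"
    and "\<And>i. i \<in> {0..k} \<Longrightarrow> convex_on UNIV (g i)"
    and "\<And>i. i \<in> {0..k} \<Longrightarrow> weakly_analytic (g i)"
    and "\<And>x. K x = {y. \<forall>i\<in>{1..k}. g i y \<le> \<phi> i x}"
    and "\<And>x. x \<in> X \<Longrightarrow> K x \<noteq> {}"
    and "\<And>x. x \<in> X \<Longrightarrow> \<phi> 0 x = (INF y\<in>K x. g 0 y)"
    and "\<And>i. i \<in> {0..k} \<Longrightarrow> continuous_on X (\<phi> i)"
    and "Y = closure (convex hull (\<Union>x\<in>X. K x))"
    and "Y \<noteq> {}"
    and "compact Y"
    and "\<And>x. S x = {y. \<forall>i\<in>{0..k}. g i y \<le> \<phi> i x}"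
  shows "(\<forall>x\<in>X. S x \<subseteq> Y) \<and> rectangularly_continuous_on X S"
proof -
  have KY: "K x \<subseteq> Y" if "x \<in> X" for x
  proof -
    have "K x \<subseteq> (\<Union>x\<in>X. K x)" using that by blast
    also have "\<dots> \<subseteq> Y"
      unfolding assms(8) using hull_subset closure_subset by (metis order_trans)
    finally show ?thesis .
  qed
  have SK: "S x \<subseteq> K x" for x
    unfolding assms(4,11) by auto
  have cont: "continuous_on UNIV (g i)" if "i \<in> {0..k}" for i
    using assms(2)[OF that] by (rule convex_on_continuous[OF open_UNIV])
  have S_ne: "S x \<noteq> {}" if x: "x \<in> X" for x
  proof -
    have "closed (K x)"
    proof -
      have "K x = (\<Inter>i\<in>{1..k}. {y. g i y \<le> \<phi> i x})" by (auto simp: assms(4))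
      then show ?thesis
        using cont by (auto intro!: closed_INT closed_Collect_le)
    qed
    \<comment> \<open>As a closed subset of \<open>Y\<close>, the feasible set is compact, so the
      infimum \<open>\<phi> 0 x\<close> is attained and its minimizers lie in
      \<open>S x\<close>.\<close>
    then have "compact (K x)"
      using KY[OF x] \<open>compact Y\<close> by (metis compact_Int_closed inf.absorb2)
    then obtain y where y: "y \<in> K x" "\<And>y'. y' \<in> K x \<Longrightarrow> g 0 y \<le> g 0 y'"
      using continuous_attains_inf[of "K x" "g 0"] assms(5)[OF x] cont[of 0] continuous_on_subset
      by (metis atLeastAtMost_iff bot_nat_0.extremum subset_UNIV)
    have "g 0 y \<le> \<phi> 0 x"
      unfolding assms(6)[OF x] using y assms(5)[OF x] by (intro cINF_greatest) auto
    then have "g i y \<le> \<phi> i x" if "i \<in> {0..k}" for i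
      using y(1) that by (cases "i = 0") (auto simp: assms(4))
    then have "y \<in> S x" by (simp add: assms(11))
    then show ?thesis by blast
  qed
  have "rectangularly_continuous_at X S x" if "x \<in> X" for x
  proof -
    interpret sublevel_map "{0..k}" g \<phi> X x S
      using assms(2,3,7,11) that S_ne by unfold_locales auto
    show ?thesis by (rule rectangularly_continuous)
  qed
  moreover have "bounded (S x)" if "x \<in> X" for x
    using SK KY[OF that] compact_imp_bounded[OF \<open>compact Y\<close>] bounded_subset by blast
  ultimately show ?thesis
    using SK KY S_ne unfolding rectangularly_continuous_on_def by blast
qed

end
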